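(* Let $\mathbb F$ be an algebraically closed field of characteristic zero, and let $\mathcal L$ be one of the one-sided Witt algebra $\mathcal W^+$, the Witt algebra $\mathcal W$, and the Virasoro algebra $\mathcal V$ over $\mathbb F$. Let $1\neq n\in\mathbb Z$ (with $n\in\mathbb Z_+$ if $\mathcal L=\mathcal W^+$), and let $(\mathcal L,[\cdot,\cdot],\Delta)$ be the coboundary triangular Lie bialgebra with cobracket $\Delta(u)=u\cdot r$ associated to the solution $r=x\otimes x^n-x^n\otimes x$ of the classical Yang–Baxter equation. Then the dual Lie bialgebra is $(\mathcal L^\circ,[\cdot,\cdot],\Delta)$, described as follows. The underlying space $\mathcal L^\circ$: if $\mathcal L=\mathcal W^+$, it is the set of all $f=\sum_{i\ge 0}f_i\varepsilon^i$ for which there are $r\in\mathbb N$ and $h_1,\dots,h_r\in\mathbb F$ with $f_m=h_1f_{m-1}+\cdots+h_rf_{m-r}$ for all $m>r$; if $\mathcal L=\mathcal W$ or $\mathcal V$, it is the set of all $f=\sum_{i\in\mathbb Z}f_i\varepsilon^i$ for which there are $r\in\mathbb N$ and $h_1,\dots,h_r\in\mathbb F$ with $f_m=h_1f_{m-1}+\cdots+h_rf_{m-r}$ for all $m\in\mathbb Z$. The cobracket is uniquely determined by $\Delta(\varepsilon^m)=\sum_{i+j=m+1}(j-i)\,\varepsilon^i\otimes\varepsilon^j$, where $m,i,j$ range over $\mathbb Z_+$ if $\mathcal L=\mathcal W^+$ and over $\mathbb Z$ if $\mathcal L=\mathcal W$ or $\mathcal V$. The bracket is uniquely determined (together with skew-symmetry)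 by the following. (1) If $\mathcal L=\mathcal W^+$, then for $i,j\in\mathbb Z_+$, $$[\varepsilon^i,\varepsilon^j]=\begin{cases}(2n-j-1)\,\varepsilon^{j+1-n}&\text{if } i=1,\ 1\ne j\ge n-1,\\ (j-1)\,\varepsilon^j&\text{if } i=n,\ j\ne 1,n,\\ 0&\text{if } i,j\notin\{1,n\}\ \text{ or }\ i=1,\ j<n-1.\end{cases}$$ (2) If $\mathcal L=\mathcal W$ or $\mathcal V$, then for $i,j\in\mathbb Z$, $$[\varepsilon^i,\varepsilon^j]=\begin{cases}(2n-j-1)\,\varepsilon^{j+1-n}&\text{if } i=1,\ j\ne 1,\\ (j-1)\,\varepsilon^j&\text{if } i=n,\ j\ne 1,n,\\ 0&\text{if } i,j\notin\{1,n\}.\end{cases}$$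
   Context: $\mathbb N$ denotes the positive integers and $\mathbb Z_+$ the nonnegative integers. Algebras. $\mathcal W^+$ is the Lie algebra on the space $\mathbb F[x]$, and $\mathcal W$ the Lie algebra on the space $\mathbb F[x,x^{-1}]$, with bracket $[a,b]=a\,\frac{db}{dx}-\frac{da}{dx}\,b$, i.e. $[x^i,x^j]=(j-i)x^{i+j-1}$. $\mathcal V$ is the universal central extension of $\mathcal W$, with basis $\{x^{m+1},c\mid m\in\mathbb Z\}$, $c$ central and $[x^{m+1},x^{n+1}]=(n-m)x^{m+n+1}+\frac{m^3-m}{12}\delta_{m+n,0}\,c$. Lie bialgebras. A Lie bialgebra is a triple $(L,[\cdot,\cdot],\delta)$ with $(L,[\cdot,\cdot])$ a Lie algebra, $(L,\delta)$ a Lie coalgebra, and $\delta[u,v]=u\cdot\delta(v)-v\cdot\delta(u)$, where $u\cdot(v\otimes w)=[u,v]\otimes w+v\otimes[u,w]$. It is coboundary if $\delta(u)=u\cdot r$ for some $r\in L\otimes L$, and triangular if moreover $r$ satisfies the classical Yang–Baxter equation $[r_{12},r_{13}]+[r_{12},r_{23}]+[r_{13},r_{23}]=0$ in $U(L)^{\otimes 3}$, where $r_{12}=r\otimes 1$, $r_{23}=1\otimes r$, and $r_{13}$ has the two legs of $r$ in positions 1 and 3. Duals. For a Lie algebra $\mathfrak g$ with bracket $\varphi:\mathfrak g\otimes\mathfrak g\to\mathfrak g$, a subspace $V\subseteq\mathfrak g^*$ is good if $\varphi^*(V)\subseteq V\otimes V$ (with $\mathfrak g^*\otimes\mathfrak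 g^*\subseteq(\mathfrak g\otimes\mathfrak g)^*$ in the natural way), and $\mathfrak g^\circ$ is the sum of all good subspaces, which is the maximal good subspace; it is a Lie coalgebra with cobracket $\varphi^\circ=\varphi^*|_{\mathfrak g^\circ}$. If $(\mathfrak g,\varphi,\delta)$ is a Lie bialgebra, then $\delta^*$ restricts to a Lie bracket $\delta^\circ:\mathfrak g^\circ\otimes\mathfrak g^\circ\to\mathfrak g^\circ$, $\delta^\circ(f\otimes g)(u)=(f\otimes g)(\delta(u))$, and $(\mathfrak g^\circ,\delta^\circ,\varphi^\circ)$ is called the dual Lie bialgebra; its bracket and cobracket are again denoted $[\cdot,\cdot]$ and $\Delta$. Dual elements. $\varepsilon^i$ is the linear functional with $\varepsilon^i(x^j)=\delta_{i,j}$ ($i,j\in\mathbb Z_+$ for $\mathcal W^+$; $i,j\in\mathbb Z$ for $\mathcal W$, $\mathcal V$), with $\varepsilon^i(c)=0$ in the case of $\mathcal V$. A possibly infinite sum $f=\sum_i f_i\varepsilon^i$ denotes the functional with $f(x^j)=f_j$ (and $f(c)=0$ for $\mathcal V$). Infinite sums of the $\varepsilon^i\otimes\varepsilon^j$ are read as elements of $(\mathcal L\otimes\mathcal L)^*$. "Uniquely determined" means extension to infinite sums by evaluation: for $f=\sum_i f_i\varepsilon^i$, $g=\sum_j g_j\varepsilon^j$ in $\mathcal L^\circ$, one has $\Delta(f)=\sum_i f_i\Delta(\varepsilon^i)$ and $[f,g]=\sum_{i,j}f_ig_j[\varepsilon^i,\varepsilon^j]$, where on each basis element of $\mathcal L\otimes\mathcal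 L$ (respectively $\mathcal L$) only finitely many terms contribute. The individual $\varepsilon^i$ need not lie in $\mathcal L^\circ$. *)

theory Defs
  imports "HOL-Computational_Algebra.Polynomial" "HOL-Library.Function_Algebras"
begin

section \<open>Tensor products of spaces of functions\<close>

text \<open>
  Every vector space below is a linear subspace \<open>V\<close> of a space of all functions \<open>'s \<Rightarrow> 'a\<close> into
  the ground field; this covers both the spaces with a given basis (finitely supported functions on
  the basis) and their duals (functions on the space itself).
  For \<open>V \<subseteq> ('s \<Rightarrow> 'a)\<close> and \<open>W \<subseteq> ('t \<Rightarrow> 'a)\<close> the natural map from the tensor product of \<open>V\<close> and \<open>W\<close>
  to the functions on \<open>'s \<times> 't\<close> is injective, so the tensor product is identified with its image.
\<close>

definition fscale :: "'a::field \<Rightarrow> ('s \<Rightarrow> 'a) \<Rightarrow> 's \<Rightarrow> 'a" where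
  "fscale c f = (\<lambda>s. c * f s)"

interpretation fun_space: vector_space fscale
  by unfold_locales (auto simp: fscale_def plus_fun_def algebra_simps fun_eq_iff)

definition linear_on :: "('s \<Rightarrow> 'a::field) set \<Rightarrow> (('s \<Rightarrow> 'a) \<Rightarrow> 't \<Rightarrow> 'a) \<Rightarrow> bool" where
  "linear_on V T \<longleftrightarrow>
     (\<forall>u\<in>V. \<forall>v\<in>V. T (u + v) = T u + T v) \<and> (\<forall>c. \<forall>u\<in>V. T (fscale c u) = fscale c (T u))"

definition pure_tensor :: "('s \<Rightarrow> 'a::field) \<Rightarrow> ('t \<Rightarrow> 'a) \<Rightarrow> 's \<times> 't \<Rightarrow> 'a" where
  "pure_tensor f g = (\<lambda>(s, t). f s * g t)"

definition tensor :: "('s \<Rightarrow> 'a::field) set \<Rightarrow> ('t \<Rightarrow> 'a) set \<Rightarrow> ('s \<times> 't \<Rightarrow> 'a) set" where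
  "tensor V W = fun_space.span {pure_tensor f g | f g. f \<in> V \<and> g \<in> W}"

definition swap_tensor :: "('s \<times> 't \<Rightarrow> 'a) \<Rightarrow> 't \<times> 's \<Rightarrow> 'a" where
  "swap_tensor \<tau> = (\<lambda>(t, s). \<tau> (s, t))"

text \<open>
  The maps \<open>T \<otimes> id\<close> and \<open>id \<otimes> T\<close>: if \<open>\<tau>\<close> lies in \<open>tensor V W\<close>, then all the slices \<open>\<tau>(\<cdot>, t)\<close> lie
  in \<open>V\<close> and all the slices \<open>\<tau>(s, \<cdot>)\<close> lie in \<open>W\<close>, and applying a linear \<open>T\<close> slicewise sends \<open>v \<otimes> w\<close>
  to \<open>T v \<otimes> w\<close> and \<open>v \<otimes> T w\<close>, respectively.
\<close>

definition map_left :: "(('s \<Rightarrow> 'a) \<Rightarrow> 'u \<Rightarrow> 'a) \<Rightarrow> ('s \<times> 't \<Rightarrow> 'a) \<Rightarrow> 'u \<times> 't \<Rightarrow> 'a" where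
  "map_left T \<tau> = (\<lambda>(u, t). T (\<lambda>s. \<tau> (s, t)) u)"

definition map_right :: "(('t \<Rightarrow> 'a) \<Rightarrow> 'u \<Rightarrow> 'a) \<Rightarrow> ('s \<times> 't \<Rightarrow> 'a) \<Rightarrow> 's \<times> 'u \<Rightarrow> 'a" where
  "map_right T \<tau> = (\<lambda>(s, u). T (\<lambda>t. \<tau> (s, t)) u)"

text \<open>The value of \<open>f \<otimes> g\<close> on \<open>\<tau>\<close>, for functionals \<open>f\<close> and \<open>g\<close>; on \<open>v \<otimes> w\<close> it is \<open>f v * g w\<close>.\<close>

definition tensor_eval ::
    "(('s \<Rightarrow> 'a) \<Rightarrow> 'a) \<Rightarrow> (('t \<Rightarrow> 'a) \<Rightarrow> 'a) \<Rightarrow> ('s \<times> 't \<Rightarrow> 'a) \<Rightarrow> 'a" where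
  "tensor_eval f g \<tau> = g (\<lambda>t. f (\<lambda>s. \<tau> (s, t)))"


section \<open>Lie algebras, Lie coalgebras and Lie bialgebras\<close>

definition lie_algebra ::
    "('s \<Rightarrow> 'a::field) set \<Rightarrow> (('s \<Rightarrow> 'a) \<Rightarrow> ('s \<Rightarrow> 'a) \<Rightarrow> 's \<Rightarrow> 'a) \<Rightarrow> bool" where
  "lie_algebra V br \<longleftrightarrow>
     fun_space.subspace V \<and>
     (\<forall>u\<in>V. \<forall>v\<in>V. br u v \<in> V) \<and>
     (\<forall>u\<in>V. linear_on V (br u) \<and> linear_on V (\<lambda>v. br v u)) \<and>
     (\<forall>u\<in>V. br u u = 0) \<and>
     (\<forall>u\<in>V. \<forall>v\<in>V. \<forall>w\<in>V. br u (br v w) + br v (br w u) + br w (br u v) = 0)"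

text \<open>
  A Lie coalgebra in the sense of Michaelis: \<open>Im \<delta> \<subseteq> Im (1 - \<tau>)\<close> with \<open>\<tau>\<close> the flip, and
  \<open>(1 + \<xi> + \<xi>\<^sup>2) (1 \<otimes> \<delta>) \<delta> = 0\<close> with \<open>\<xi>\<close> the cyclic permutation of the three tensor factors.
\<close>

definition lie_coalgebra ::
    "('s \<Rightarrow> 'a::field) set \<Rightarrow> (('s \<Rightarrow> 'a) \<Rightarrow> 's \<times> 's \<Rightarrow> 'a) \<Rightarrow> bool" where
  "lie_coalgebra V \<delta> \<longleftrightarrow>
     fun_space.subspace V \<and>
     (\<forall>u\<in>V. \<delta> u \<in> tensor V V) \<and>
     linear_on V \<delta> \<and>
     (\<forall>u\<in>V. \<exists>\<rho>\<in>tensor V V. \<delta> u = \<rho> - swap_tensor \<rho>) \<and>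
     (\<forall>u\<in>V. \<forall>s t w.
        map_right \<delta> (\<delta> u) (s, (t, w)) + map_right \<delta> (\<delta> u) (t, (w, s)) +
        map_right \<delta> (\<delta> u) (w, (s, t)) = 0)"

text \<open>The action \<open>u \<cdot> (v \<otimes> w) = [u, v] \<otimes> w + v \<otimes> [u, w]\<close>.\<close>

definition tensor_act ::
    "(('s \<Rightarrow> 'a::field) \<Rightarrow> ('s \<Rightarrow> 'a) \<Rightarrow> 's \<Rightarrow> 'a) \<Rightarrow> ('s \<Rightarrow> 'a) \<Rightarrow> ('s \<times> 's \<Rightarrow> 'a) \<Rightarrow> 's \<times> 's \<Rightarrow> 'a"
  where "tensor_act br u \<tau> = map_left (br u) \<tau> + map_right (br u) \<tau>"

definition lie_bialgebra ::
    "('s \<Rightarrow> 'a::field) set \<Rightarrow> (('s \<Rightarrow> 'a) \<Rightarrow> ('s \<Rightarrow> 'a) \<Rightarrow> 's \<Rightarrow> 'a) \<Rightarrow>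
       (('s \<Rightarrow> 'a) \<Rightarrow> 's \<times> 's \<Rightarrow> 'a) \<Rightarrow> bool" where
  "lie_bialgebra V br \<delta> \<longleftrightarrow>
     lie_algebra V br \<and> lie_coalgebra V \<delta> \<and>
     (\<forall>u\<in>V. \<forall>v\<in>V. \<delta> (br u v) = tensor_act br u (\<delta> v) - tensor_act br v (\<delta> u))"


section \<open>The classical Yang--Baxter equation in the enveloping algebra\<close>

text \<open>
  The tensor algebra \<open>T(V)\<close> consists of functions on words over the index type, with the
  concatenation product; its degree \<open>k\<close> part lives on the words of length \<open>k\<close>.  The enveloping
  algebra is \<open>U(V) = T(V) / I\<close> with \<open>I\<close> the two-sided ideal generated by all
  \<open>u \<otimes> v - v \<otimes> u - [u, v]\<close>, and its third tensor power is the quotient of the third tensor power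
  of \<open>T(V)\<close> by \<open>I \<otimes> T \<otimes> T + T \<otimes> I \<otimes> T + T \<otimes> T \<otimes> I\<close>.
\<close>

definition word_mult :: "('s list \<Rightarrow> 'a::field) \<Rightarrow> ('s list \<Rightarrow> 'a) \<Rightarrow> 's list \<Rightarrow> 'a" where
  "word_mult p q = (\<lambda>xs. \<Sum>k\<le>length xs. p (take k xs) * q (drop k xs))"

definition word_one :: "'s list \<Rightarrow> 'a::field" where
  "word_one = (\<lambda>xs. if xs = [] then 1 else 0)"

definition word_emb :: "('s \<Rightarrow> 'a::field) \<Rightarrow> 's list \<Rightarrow> 'a" where
  "word_emb v = (\<lambda>xs. if length xs = 1 then v (hd xs) else 0)"

definition tensor_algebra :: "('s \<Rightarrow> 'a::field) set \<Rightarrow> ('s list \<Rightarrow> 'a) set" where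
  "tensor_algebra V =
     fun_space.span {foldr word_mult (map word_emb vs) word_one | vs. set vs \<subseteq> V}"

definition enveloping_ideal ::
    "('s \<Rightarrow> 'a::field) set \<Rightarrow> (('s \<Rightarrow> 'a) \<Rightarrow> ('s \<Rightarrow> 'a) \<Rightarrow> 's \<Rightarrow> 'a) \<Rightarrow> ('s list \<Rightarrow> 'a) set" where
  "enveloping_ideal V br = fun_space.span
     {word_mult p (word_mult
        (word_mult (word_emb u) (word_emb v) - word_mult (word_emb v) (word_emb u)
           - word_emb (br u v)) q) | p q u v.
        p \<in> tensor_algebra V \<and> q \<in> tensor_algebra V \<and> u \<in> V \<and> v \<in> V}"

definition enveloping_null3 ::
    "('s \<Rightarrow> 'a::field) set \<Rightarrow> (('s \<Rightarrow> 'a) \<Rightarrow> ('s \<Rightarrow> 'a) \<Rightarrow> 's \<Rightarrow> 'a) \<Rightarrow>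
       ('s list \<times> 's list \<times> 's list \<Rightarrow> 'a) set" where
  "enveloping_null3 V br =
     (let T = tensor_algebra V; I = enveloping_ideal V br in
      fun_space.span (tensor I (tensor T T) \<union> tensor T (tensor I T) \<union> tensor T (tensor T I)))"

definition word_mult3 ::
    "('s list \<times> 's list \<times> 's list \<Rightarrow> 'a::field) \<Rightarrow> ('s list \<times> 's list \<times> 's list \<Rightarrow> 'a) \<Rightarrow>
       's list \<times> 's list \<times> 's list \<Rightarrow> 'a" where
  "word_mult3 P Q = (\<lambda>(xs, ys, zs). \<Sum>i\<le>length xs. \<Sum>j\<le>length ys. \<Sum>k\<le>length zs.
     P (take i xs, take j ys, take k zs) * Q (drop i xs, drop j ys, drop k zs))"

definition commutator3 ::
    "('s list \<times> 's list \<times> 's list \<Rightarrow> 'a::field) \<Rightarrow> ('s list \<times> 's list \<times> 's list \<Rightarrow> 'a) \<Rightarrow>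
       's list \<times> 's list \<times> 's list \<Rightarrow> 'a" where
  "commutator3 P Q = word_mult3 P Q - word_mult3 Q P"

definition leg12 :: "('s \<times> 's \<Rightarrow> 'a::field) \<Rightarrow> 's list \<times> 's list \<times> 's list \<Rightarrow> 'a" where
  "leg12 r = (\<lambda>(xs, ys, zs).
     if length xs = 1 \<and> length ys = 1 \<and> zs = [] then r (hd xs, hd ys) else 0)"

definition leg13 :: "('s \<times> 's \<Rightarrow> 'a::field) \<Rightarrow> 's list \<times> 's list \<times> 's list \<Rightarrow> 'a" where
  "leg13 r = (\<lambda>(xs, ys, zs).
     if length xs = 1 \<and> ys = [] \<and> length zs = 1 then r (hd xs, hd zs) else 0)"

definition leg23 :: "('s \<times> 's \<Rightarrow> 'a::field) \<Rightarrow> 's list \<times> 's list \<times> 's list \<Rightarrow> 'a" where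
  "leg23 r = (\<lambda>(xs, ys, zs).
     if xs = [] \<and> length ys = 1 \<and> length zs = 1 then r (hd ys, hd zs) else 0)"

definition CYBE ::
    "('s \<Rightarrow> 'a::field) set \<Rightarrow> (('s \<Rightarrow> 'a) \<Rightarrow> ('s \<Rightarrow> 'a) \<Rightarrow> 's \<Rightarrow> 'a) \<Rightarrow> ('s \<times> 's \<Rightarrow> 'a) \<Rightarrow> bool" where
  "CYBE V br r \<longleftrightarrow>
     commutator3 (leg12 r) (leg13 r) + commutator3 (leg12 r) (leg23 r)
       + commutator3 (leg13 r) (leg23 r) \<in> enveloping_null3 V br"

definition coboundary_lie_bialgebra ::
    "('s \<Rightarrow> 'a::field) set \<Rightarrow> (('s \<Rightarrow> 'a) \<Rightarrow> ('s \<Rightarrow> 'a) \<Rightarrow> 's \<Rightarrow> 'a) \<Rightarrow>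
       (('s \<Rightarrow> 'a) \<Rightarrow> 's \<times> 's \<Rightarrow> 'a) \<Rightarrow> ('s \<times> 's \<Rightarrow> 'a) \<Rightarrow> bool" where
  "coboundary_lie_bialgebra V br \<delta> r \<longleftrightarrow>
     lie_bialgebra V br \<delta> \<and> r \<in> tensor V V \<and> (\<forall>u\<in>V. \<delta> u = tensor_act br u r)"

definition triangular_lie_bialgebra ::
    "('s \<Rightarrow> 'a::field) set \<Rightarrow> (('s \<Rightarrow> 'a) \<Rightarrow> ('s \<Rightarrow> 'a) \<Rightarrow> 's \<Rightarrow> 'a) \<Rightarrow>
       (('s \<Rightarrow> 'a) \<Rightarrow> 's \<times> 's \<Rightarrow> 'a) \<Rightarrow> ('s \<times> 's \<Rightarrow> 'a) \<Rightarrow> bool" where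
  "triangular_lie_bialgebra V br \<delta> r \<longleftrightarrow> coboundary_lie_bialgebra V br \<delta> r \<and> CYBE V br r"


section \<open>The dual Lie bialgebra\<close>

text \<open>
  Functionals on \<open>V\<close> are normalised to vanish outside \<open>V\<close>, so that equality of functionals is
  equality of functions.  In the same way \<open>(V \<otimes> V)\<^sup>*\<close> is identified with the bilinear forms on
  \<open>V \<times> V\<close>, extended by zero; under this identification \<open>pure_tensor f g\<close> is the image of \<open>f \<otimes> g\<close>.
\<close>

definition dual_space :: "('s \<Rightarrow> 'a::field) set \<Rightarrow> (('s \<Rightarrow> 'a) \<Rightarrow> 'a) set" where
  "dual_space V = {f. (\<forall>u\<in>V. \<forall>v\<in>V. f (u + v) = f u + f v) \<and>
                      (\<forall>c. \<forall>u\<in>V. f (fscale c u) = c * f u) \<and> (\<forall>u. u \<notin> V \<longrightarrow> f u = 0)}"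

definition dual_cobracket ::
    "('s \<Rightarrow> 'a::field) set \<Rightarrow> (('s \<Rightarrow> 'a) \<Rightarrow> ('s \<Rightarrow> 'a) \<Rightarrow> 's \<Rightarrow> 'a) \<Rightarrow>
       (('s \<Rightarrow> 'a) \<Rightarrow> 'a) \<Rightarrow> ('s \<Rightarrow> 'a) \<times> ('s \<Rightarrow> 'a) \<Rightarrow> 'a" where
  "dual_cobracket V br f = (\<lambda>(u, v). if u \<in> V \<and> v \<in> V then f (br u v) else 0)"

definition dual_bracket ::
    "('s \<Rightarrow> 'a::field) set \<Rightarrow> (('s \<Rightarrow> 'a) \<Rightarrow> 's \<times> 's \<Rightarrow> 'a) \<Rightarrow>
       (('s \<Rightarrow> 'a) \<Rightarrow> 'a) \<Rightarrow> (('s \<Rightarrow> 'a) \<Rightarrow> 'a) \<Rightarrow> ('s \<Rightarrow> 'a) \<Rightarrow> 'a" where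
  "dual_bracket V \<delta> f g = (\<lambda>u. if u \<in> V then tensor_eval f g (\<delta> u) else 0)"

definition good_subspace ::
    "('s \<Rightarrow> 'a::field) set \<Rightarrow> (('s \<Rightarrow> 'a) \<Rightarrow> ('s \<Rightarrow> 'a) \<Rightarrow> 's \<Rightarrow> 'a) \<Rightarrow>
       (('s \<Rightarrow> 'a) \<Rightarrow> 'a) set \<Rightarrow> bool" where
  "good_subspace V br G \<longleftrightarrow>
     fun_space.subspace G \<and> G \<subseteq> dual_space V \<and> (\<forall>f\<in>G. dual_cobracket V br f \<in> tensor G G)"

definition finite_dual ::
    "('s \<Rightarrow> 'a::field) set \<Rightarrow> (('s \<Rightarrow> 'a) \<Rightarrow> ('s \<Rightarrow> 'a) \<Rightarrow> 's \<Rightarrow> 'a) \<Rightarrow> (('s \<Rightarrow> 'a) \<Rightarrow> 'a) set"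
  where "finite_dual V br = fun_space.span (\<Union>{G. good_subspace V br G})"


section \<open>The one-sided Witt, Witt and Virasoro algebras\<close>

datatype witt_kind = One_Sided_Witt | Two_Sided_Witt | Virasoro

datatype witt_index = Pow int | Central

definition exponents :: "witt_kind \<Rightarrow> int set" where
  "exponents K = (if K = One_Sided_Witt then {0..} else UNIV)"

definition witt_basis :: "witt_kind \<Rightarrow> witt_index set" where
  "witt_basis K = Pow ` exponents K \<union> (if K = Virasoro then {Central} else {})"

definition witt_space :: "witt_kind \<Rightarrow> (witt_index \<Rightarrow> 'a::field_char_0) set" where
  "witt_space K = {u. finite {b. u b \<noteq> 0} \<and> {b. u b \<noteq> 0} \<subseteq> witt_basis K}"

definition unit_vector :: "witt_index \<Rightarrow> witt_index \<Rightarrow> 'a::field_char_0" where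
  "unit_vector b = (\<lambda>b'. if b' = b then 1 else 0)"

abbreviation xpow :: "int \<Rightarrow> witt_index \<Rightarrow> 'a::field_char_0" where
  "xpow i \<equiv> unit_vector (Pow i)"

text \<open>
  The central term is that of \<open>[x\<^bsup>m+1\<^esup>, x\<^bsup>n+1\<^esup>]\<close> with \<open>m = i - 1\<close> and \<open>n = j - 1\<close>.
\<close>

fun basis_bracket ::
    "witt_kind \<Rightarrow> witt_index \<Rightarrow> witt_index \<Rightarrow> witt_index \<Rightarrow> 'a::field_char_0" where
  "basis_bracket K (Pow i) (Pow j) =
     fscale (of_int (j - i)) (xpow (i + j - 1)) +
     (if K = Virasoro \<and> (i - 1) + (j - 1) = 0
      then fscale (of_int ((i - 1) ^ 3 - (i - 1)) / 12) (unit_vector Central) else 0)"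
| "basis_bracket K Central b = 0"
| "basis_bracket K b Central = 0"

definition witt_bracket ::
    "witt_kind \<Rightarrow> (witt_index \<Rightarrow> 'a::field_char_0) \<Rightarrow> (witt_index \<Rightarrow> 'a) \<Rightarrow> witt_index \<Rightarrow> 'a" where
  "witt_bracket K u v =
     (\<Sum>b | u b \<noteq> 0. \<Sum>b' | v b' \<noteq> 0. fscale (u b * v b') (basis_bracket K b b'))"

definition witt_r :: "int \<Rightarrow> witt_index \<times> witt_index \<Rightarrow> 'a::field_char_0" where
  "witt_r n = pure_tensor (xpow 1) (xpow n) - pure_tensor (xpow n) (xpow 1)"

definition witt_cobracket ::
    "witt_kind \<Rightarrow> int \<Rightarrow> (witt_index \<Rightarrow> 'a::field_char_0) \<Rightarrow> witt_index \<times> witt_index \<Rightarrow> 'a" where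
  "witt_cobracket K n u = tensor_act (witt_bracket K) u (witt_r n)"


section \<open>Infinite sums of dual elements\<close>

text \<open>
  \<open>eps_sum K F\<close> is the functional \<open>\<Sum>\<^sub>i F i \<epsilon>\<^sup>i\<close>, vanishing at the central element.  The exponents
  outside \<open>exponents K\<close> do not contribute, because \<open>u\<close> vanishes there.
\<close>

definition eps_sum ::
    "witt_kind \<Rightarrow> (int \<Rightarrow> 'a::field_char_0) \<Rightarrow> (witt_index \<Rightarrow> 'a) \<Rightarrow> 'a" where
  "eps_sum K F = (\<lambda>u. if u \<in> witt_space K then \<Sum>i | u (Pow i) \<noteq> 0. F i * u (Pow i) else 0)"

definition eps :: "witt_kind \<Rightarrow> int \<Rightarrow> (witt_index \<Rightarrow> 'a::field_char_0) \<Rightarrow> 'a" where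
  "eps K i = eps_sum K (\<lambda>j. if j = i then 1 else 0)"

definition recurrent :: "witt_kind \<Rightarrow> (int \<Rightarrow> 'a::field_char_0) \<Rightarrow> bool" where
  "recurrent K F \<longleftrightarrow>
     (\<exists>r::nat. r \<ge> 1 \<and> (\<exists>h :: nat \<Rightarrow> 'a. \<forall>m::int. (K = One_Sided_Witt \<longrightarrow> m > int r) \<longrightarrow>
        F m = (\<Sum>k = 1..r. h k * F (m - int k))))"

text \<open>
  \<open>g\<close> is the sum by evaluation of the possibly infinite family \<open>\<Phi>\<close>: at each argument only finitely
  many terms contribute (for linear terms it suffices to ask this on a basis).
\<close>

definition sums_by_evaluation :: "'i set \<Rightarrow> ('i \<Rightarrow> 'p \<Rightarrow> 'a::field) \<Rightarrow> ('p \<Rightarrow> 'a) \<Rightarrow> bool" where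
  "sums_by_evaluation I \<Phi> g \<longleftrightarrow>
     (\<forall>p. finite {i \<in> I. \<Phi> i p \<noteq> 0} \<and> g p = (\<Sum>i | i \<in> I \<and> \<Phi> i p \<noteq> 0. \<Phi> i p))"

text \<open>
  The conditions that are said to determine the cobracket and the bracket on the space \<open>D\<close>.  The
  \<open>\<epsilon>\<^sup>i\<close> need not lie in \<open>D\<close>, so \<open>\<Delta>\<close> and \<open>B\<close> are given on arbitrary functionals.
\<close>

definition cobracket_description ::
    "witt_kind \<Rightarrow> ((witt_index \<Rightarrow> 'a::field_char_0) \<Rightarrow> 'a) set \<Rightarrow>
       (((witt_index \<Rightarrow> 'a) \<Rightarrow> 'a) \<Rightarrow> (witt_index \<Rightarrow> 'a) \<times> (witt_index \<Rightarrow> 'a) \<Rightarrow> 'a) \<Rightarrow> bool" where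
  "cobracket_description K D \<Delta> \<longleftrightarrow>
     (\<forall>m\<in>exponents K. sums_by_evaluation
        {(i, j). i \<in> exponents K \<and> j \<in> exponents K \<and> i + j = m + 1}
        (\<lambda>(i, j). fscale (of_int (j - i)) (pure_tensor (eps K i) (eps K j)))
        (\<Delta> (eps K m))) \<and>
     (\<forall>F. eps_sum K F \<in> D \<longrightarrow>
        sums_by_evaluation (exponents K) (\<lambda>m. fscale (F m) (\<Delta> (eps K m))) (\<Delta> (eps_sum K F)))"

definition bracket_table ::
    "witt_kind \<Rightarrow> int \<Rightarrow>
       (((witt_index \<Rightarrow> 'a::field_char_0) \<Rightarrow> 'a) \<Rightarrow> ((witt_index \<Rightarrow> 'a) \<Rightarrow> 'a) \<Rightarrow>
          (witt_index \<Rightarrow> 'a) \<Rightarrow> 'a) \<Rightarrow> bool" where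
  "bracket_table K n B \<longleftrightarrow>
     (if K = One_Sided_Witt then
        \<forall>i\<ge>0. \<forall>j\<ge>0.
          (i = 1 \<and> j \<noteq> 1 \<and> j \<ge> n - 1 \<longrightarrow>
             B (eps K i) (eps K j) = fscale (of_int (2 * n - j - 1)) (eps K (j + 1 - n))) \<and>
          (i = n \<and> j \<noteq> 1 \<and> j \<noteq> n \<longrightarrow>
             B (eps K i) (eps K j) = fscale (of_int (j - 1)) (eps K j)) \<and>
          ((i \<notin> {1, n} \<and> j \<notin> {1, n}) \<or> (i = 1 \<and> j < n - 1) \<longrightarrow>
             B (eps K i) (eps K j) = 0)
      else
        \<forall>i j.
          (i = 1 \<and> j \<noteq> 1 \<longrightarrow>
             B (eps K i) (eps K j) = fscale (of_int (2 * n - j - 1)) (eps K (j + 1 - n))) \<and>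
          (i = n \<and> j \<noteq> 1 \<and> j \<noteq> n \<longrightarrow>
             B (eps K i) (eps K j) = fscale (of_int (j - 1)) (eps K j)) \<and>
          (i \<notin> {1, n} \<and> j \<notin> {1, n} \<longrightarrow>
             B (eps K i) (eps K j) = 0))"

definition bracket_description ::
    "witt_kind \<Rightarrow> int \<Rightarrow> ((witt_index \<Rightarrow> 'a::field_char_0) \<Rightarrow> 'a) set \<Rightarrow>
       (((witt_index \<Rightarrow> 'a) \<Rightarrow> 'a) \<Rightarrow> ((witt_index \<Rightarrow> 'a) \<Rightarrow> 'a) \<Rightarrow>
          (witt_index \<Rightarrow> 'a) \<Rightarrow> 'a) \<Rightarrow> bool" where
  "bracket_description K n D B \<longleftrightarrow>
     bracket_table K n B \<and>
     (\<forall>i\<in>exponents K. \<forall>j\<in>exponents K. B (eps K j) (eps K i) = - B (eps K i) (eps K j)) \<and>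
     (\<forall>F G. eps_sum K F \<in> D \<and> eps_sum K G \<in> D \<longrightarrow>
        sums_by_evaluation (exponents K \<times> exponents K)
          (\<lambda>(i, j). fscale (F i * G j) (B (eps K i) (eps K j)))
          (B (eps_sum K F) (eps_sum K G)))"

end

theory Submission
  imports Defs
begin

text \<open>
  The Lie bialgebra axioms hold for \<open>r = a \<otimes> b - b \<otimes> a\<close> over any Lie algebra in which \<open>[a, b]\<close> is a
  multiple of \<open>b\<close>, and for the dual structure on any good subspace; here \<open>a = x\<close>, \<open>b = x\<^sup>n\<close>.

  If \<open>f\<close> lies in a good subspace, then the form \<open>f [u, v]\<close> has finite rank, so its radical contains
  polynomials \<open>c\<close> and \<open>d\<close> of different degrees. Applying \<open>f (a c' - a' c) = 0\<close> to \<open>a = b d\<close> and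
  \<open>f (a d' - a' d) = 0\<close> to \<open>a = b c\<close> and subtracting gives \<open>2 f (b (d c' - c d')) = 0\<close> for all \<open>b\<close>:
  the coefficients of \<open>f\<close> satisfy the linear recurrence given by the Wronskian, which is nonzero.
  Conversely, if \<open>f\<close> vanishes on the ideal generated by \<open>g\<close>, then all \<open>f [u, \<cdot>]\<close> vanish on the
  ideal generated by \<open>x g\<^sup>2\<close>, and the functionals with this property form a finite-dimensional
  space.
\<close>

section \<open>Tensors\<close>

text \<open>One radical element c yields f (x^i c') = i f (x^(i-1) c), a relation whose coefficients
  depend on i. A second one is needed to eliminate i, and only then do the coefficients become
  constant. Both exist because a form of rank R has a nonzero radical element supported on any
  prescribed R + 1 exponents; taking 0..R and R+1..2R+1 separates the degrees, and in characteristic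
  zero the leading terms of d c' and c d' then differ. The square in the converse is there because
  the derivative of a multiple of g^2 is still a multiple of g. Two obstacles shape the rest. For
  the Virasoro algebra the form f [u, v] also contains the cocycle times the value of f at the
  central element, so that value has to be shown to vanish before the argument starts. And in the
  two-sided cases no \<epsilon>^i satisfies a linear recurrence, so the tables for bracket and
  cobracket are computed in the full dual and transferred by evaluation at finitely supported
  vectors.\<close>

lemma fscale_apply [simp]: "fscale c f s = c * f s"
  by (simp add: fscale_def)

lemma pure_tensor_apply [simp]: "pure_tensor f g (s, t) = f s * g t"
  by (simp add: pure_tensor_def)

lemma sum_fun_apply: "(\<Sum>i\<in>A. f i) x = (\<Sum>i\<in>A. f i x)"
  by (induction A rule: infinite_finite_induct) auto

lemma pure_tensor_in_tensor: "f \<in> V \<Longrightarrow> g \<in> W \<Longrightarrow> pure_tensor f g \<in> tensor V W"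
  unfolding tensor_def by (rule fun_space.span_base) blast

lemma subspace_tensor: "fun_space.subspace (tensor V W)"
  unfolding tensor_def by (rule fun_space.subspace_span)

lemma tensor_mono: "V \<subseteq> V' \<Longrightarrow> W \<subseteq> W' \<Longrightarrow> tensor V W \<subseteq> tensor V' W'"
  unfolding tensor_def by (rule fun_space.span_mono) blast

lemma tensor_column:
  assumes V: "fun_space.subspace V" and "\<tau> \<in> tensor V W"
  shows "(\<lambda>s. \<tau> (s, t)) \<in> V"
  using assms(2) unfolding tensor_def
proof (induction rule: fun_space.span_induct_alt)
  case base
  then show ?case using fun_space.subspace_0[OF V] by (simp add: zero_fun_def)
next
  case (step c x y)
  then obtain f g where "x = pure_tensor f g" "f \<in> V" by blast
  then have "(\<lambda>s. (fscale c x + y) (s, t)) = fscale (c * g t) f + (\<lambda>s. y (s, t))"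
    by (auto simp: fun_eq_iff)
  then show ?case
    using \<open>f \<in> V\<close> step.IH by (simp add: V fun_space.subspace_add fun_space.subspace_scale)
qed

text \<open>What maximality extracts from membership in \<open>tensor G G\<close>: a matrix of
  finite rank, to which linear algebra on the exponents applies.\<close>

lemma tensor_finite_rank:
  assumes "\<tau> \<in> tensor V W"
  shows "\<exists>(R::nat) p q. \<forall>s t. \<tau> (s, t) = (\<Sum>k<R. p k s * q k t)"
  using assms unfolding tensor_def
proof (induction rule: fun_space.span_induct_alt)
  case base
  show ?case by (rule exI[of _ 0]) auto
next
  case (step c x y)
  then obtain f g where x: "x = pure_tensor f g" by blast
  obtain R :: nat and p q where y: "\<And>s t. y (s, t) = (\<Sum>k<R. p k s * q k t)"
    using step by blast
  have "(fscale c x + y) (s, t) =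
      (\<Sum>k<Suc R. (p(R := fscale c f)) k s * (q(R := g)) k t)" for s t
    by (simp add: x y)
  then show ?case by (intro exI allI)
qed

text \<open>
  Gaussian elimination: \<open>P\<close> is a set of points whose values determine the elements of \<open>W\<close>, and
  subtracting a rank one tensor from \<open>\<tau>\<close> makes one of these points superfluous.
\<close>

lemma tensorI:
  assumes "finite P" and V: "fun_space.subspace V" and "fun_space.subspace W"
    and "\<And>t. (\<lambda>s. \<tau> (s, t)) \<in> V" and "\<And>s. (\<lambda>t. \<tau> (s, t)) \<in> W"
    and "\<And>w. w \<in> W \<Longrightarrow> (\<And>t. t \<in> P \<Longrightarrow> w t = 0) \<Longrightarrow> w = 0"
  shows "\<tau> \<in> tensor V W"
  using assms(1,3-6)
proof (induction P arbitrary: \<tau> W rule: finite_induct)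
  case empty
  then have "(\<lambda>t. \<tau> (s, t)) = 0" for s by blast
  then have "\<tau> = 0" by (auto simp: fun_eq_iff)
  then show ?case using fun_space.subspace_0[OF subspace_tensor] by blast
next
  case (insert t\<^sub>0 P)
  define W' where "W' = {w \<in> W. w t\<^sub>0 = 0}"
  have W': "fun_space.subspace W'"
    using insert.prems(1) unfolding W'_def fun_space.subspace_def by auto
  have det: "w = 0" if "w \<in> W'" "\<And>t. t \<in> P \<Longrightarrow> w t = 0" for w
    by (rule insert.prems(4)) (use that in \<open>auto simp: W'_def\<close>)
  show ?case
  proof (cases "\<forall>s. \<tau> (s, t\<^sub>0) = 0")
    case True
    \<comment> \<open>Column \<open>t\<^sub>0\<close> vanishes, so all rows already lie in
      \<open>W'\<close>, whose elements are determined by \<open>P\<close> alone.\<close>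
    have "\<tau> \<in> tensor V W'"
      using insert.prems(2,3) True by (intro insert.IH[OF W' _ _ det]) (auto simp: W'_def)
    then show ?thesis using tensor_mono[of V V W' W] by (auto simp: W'_def)
  next
    case False
    then obtain s\<^sub>0 where s0: "\<tau> (s\<^sub>0, t\<^sub>0) \<noteq> 0" by blast
    \<comment> \<open>The cross through the pivot \<open>(s\<^sub>0, t\<^sub>0)\<close>: dividing by
      the pivot makes \<sigma> vanish on column \<open>t\<^sub>0\<close>.\<close>
    define f where "f = fscale (1 / \<tau> (s\<^sub>0, t\<^sub>0)) (\<lambda>s. \<tau> (s, t\<^sub>0))"
    define g where "g = (\<lambda>t. \<tau> (s\<^sub>0, t))"
    define \<sigma> where "\<sigma> = \<tau> - pure_tensor f g"
    have f: "f \<in> V" unfolding f_def by (intro fun_space.subspace_scale V insert.prems)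
    have g: "g \<in> W" unfolding g_def by (rule insert.prems)
    have "(\<lambda>s. \<sigma> (s, t)) = (\<lambda>s. \<tau> (s, t)) - fscale (g t) f" for t
      by (auto simp: \<sigma>_def fun_eq_iff)
    then have col: "(\<lambda>s. \<sigma> (s, t)) \<in> V" for t
      using fun_space.subspace_diff[OF V insert.prems(2) fun_space.subspace_scale[OF V f]] by simp
    have "(\<lambda>t. \<sigma> (s, t)) = (\<lambda>t. \<tau> (s, t)) - fscale (f s) g" for s
      by (auto simp: \<sigma>_def fun_eq_iff)
    then have row: "(\<lambda>t. \<sigma> (s, t)) \<in> W" for s
      using fun_space.subspace_diff[OF insert.prems(1,3) fun_space.subspace_scale[OF
        insert.prems(1) g]]
      by simp
    have "\<sigma> (s, t\<^sub>0) = 0" for s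
      using s0 by (simp add: \<sigma>_def f_def g_def)
    with row have "(\<lambda>t. \<sigma> (s, t)) \<in> W'" for s by (simp add: W'_def)
    from insert.IH[OF W' col this det] have "\<sigma> \<in> tensor V W'" by blast
    then have "\<sigma> \<in> tensor V W" using tensor_mono[of V V W' W] by (auto simp: W'_def)
    then have "\<sigma> + pure_tensor f g \<in> tensor V W"
      by (intro fun_space.subspace_add subspace_tensor pure_tensor_in_tensor f g)
    then show ?thesis by (simp add: \<sigma>_def)
  qed
qed

text \<open>Elimination of one unknown per equation. The index set \<open>J\<close> is left free so
  that the solution gets a prescribed support, which later controls the degrees of
  polynomials.\<close>

lemma underdetermined_system:
  fixes q :: "nat \<Rightarrow> 'b \<Rightarrow> 'a::field"
  assumes "finite J" "card J > R"
  shows "\<exists>v. (\<exists>j\<in>J. v j \<noteq> 0) \<and> (\<forall>k<R. (\<Sum>j\<in>J. v j * q k j) = 0)"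
  using assms
proof (induction R arbitrary: q J)
  case 0
  then obtain j where "j \<in> J" by fastforce
  then show ?case by (intro exI[of _ "\<lambda>_. 1"]) auto
next
  case (Suc R)
  show ?case
  proof (cases "\<forall>j\<in>J. q R j = 0")
    case True
    obtain v where "\<exists>j\<in>J. v j \<noteq> 0" "\<forall>k<R. (\<Sum>j\<in>J. v j * q k j) = 0"
      using Suc.IH[of J q] Suc.prems by auto
    moreover have "(\<Sum>j\<in>J. v j * q R j) = 0" using True by simp
    ultimately show ?thesis by (auto simp: less_Suc_eq)
  next
    case False
    then obtain j0 where j0: "j0 \<in> J" "q R j0 \<noteq> 0" by blast
    \<comment> \<open>Equation \<open>R\<close> solved for the unknown \<open>j0\<close> and
      substituted into equation \<open>k\<close>.\<close>
    define q' where "q' k j = q k j - q k j0 * q R j / q R j0" for k j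
    have "card (J - {j0}) > R" using Suc.prems j0 by simp
    then obtain v where v: "\<exists>j\<in>J - {j0}. v j \<noteq> 0"
        "\<And>k. k < R \<Longrightarrow> (\<Sum>j\<in>J - {j0}. v j * q' k j) = 0"
      using Suc.IH[of "J - {j0}" q'] Suc.prems(1) by auto
    define S where "S = (\<Sum>j\<in>J - {j0}. v j * q R j)"
    \<comment> \<open>Back substitution: the value at \<open>j0\<close> is the one that makes
      equation \<open>R\<close> hold.\<close>
    define v' where "v' = v(j0 := - S / q R j0)"
    have split: "(\<Sum>j\<in>J. v' j * q k j) = - S / q R j0 * q k j0 + (\<Sum>j\<in>J - {j0}. v j * q k j)" for k
      using Suc.prems(1) j0(1) by (subst sum.remove[of _ j0]) (auto simp: v'_def intro!: sum.cong)
    have "(\<Sum>j\<in>J - {j0}. v j * q' k j) = - S / q R j0 * q k j0 + (\<Sum>j\<in>J - {j0}. v j * q k j)" for k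
      by (simp add: q'_def S_def right_diff_distrib sum_subtractf sum_distrib_right sum_distrib_left
          sum_divide_distrib sum_negf field_simps)
    with split v(2) have "(\<Sum>j\<in>J. v' j * q k j) = 0" if "k < R" for k
      using that by metis
    moreover have "(\<Sum>j\<in>J. v' j * q R j) = 0"
      using j0(2) by (simp add: split S_def)
    moreover have "\<exists>j\<in>J. v' j \<noteq> 0" using v(1) by (auto simp: v'_def)
    ultimately show ?thesis by (auto simp: less_Suc_eq)
  qed
qed

section \<open>The triangular Lie bialgebra of a pair with $[a,b]$ proportional to $b$\<close>

lemma dual_space_add: "f \<in> dual_space V \<Longrightarrow> u \<in> V \<Longrightarrow> v \<in> V \<Longrightarrow> f (u + v) = f u + f v"
  and dual_space_scale: "f \<in> dual_space V \<Longrightarrow> u \<in> V \<Longrightarrow> f (fscale x u) = x * f u"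
  and dual_space_outside: "f \<in> dual_space V \<Longrightarrow> u \<notin> V \<Longrightarrow> f u = 0"
  by (auto simp: dual_space_def)

lemma fscale_minus_one: "- u = fscale (-1) u"
  by (auto simp: fun_eq_iff)

lemma dual_space_minus:
  assumes "f \<in> dual_space V" "u \<in> V"
  shows "f (- u) = - f u"
proof -
  have "f (fscale (-1) u) = -1 * f u" by (rule dual_space_scale[OF assms])
  then show ?thesis by (simp only: fscale_minus_one mult_minus1)
qed

locale lie_algebra_on =
  fixes V :: "('s \<Rightarrow> 'a::field_char_0) set" and br :: "('s \<Rightarrow> 'a) \<Rightarrow> ('s \<Rightarrow> 'a) \<Rightarrow> 's \<Rightarrow> 'a"
  assumes lie: "lie_algebra V br"
begin

lemma subspace: "fun_space.subspace V"
  using lie by (simp add: lie_algebra_def)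

lemma zero_closed [simp]: "0 \<in> V"
  and add_closed [simp]: "u \<in> V \<Longrightarrow> v \<in> V \<Longrightarrow> u + v \<in> V"
  and diff_closed [simp]: "u \<in> V \<Longrightarrow> v \<in> V \<Longrightarrow> u - v \<in> V"
  and scale_closed [simp]: "u \<in> V \<Longrightarrow> fscale x u \<in> V"
  and bracket_closed [simp]: "u \<in> V \<Longrightarrow> v \<in> V \<Longrightarrow> br u v \<in> V"
  using lie subspace
  by (auto simp: lie_algebra_def intro: fun_space.subspace_0 fun_space.subspace_add
      fun_space.subspace_diff fun_space.subspace_scale)

lemma bracket_add_right: "u \<in> V \<Longrightarrow> v \<in> V \<Longrightarrow> w \<in> V \<Longrightarrow> br u (v + w) = br u v + br u w"
  and bracket_add_left: "u \<in> V \<Longrightarrow> v \<in> V \<Longrightarrow> w \<in> V \<Longrightarrow> br (v + w) u = br v u + br w u"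
  and bracket_scale_right: "u \<in> V \<Longrightarrow> v \<in> V \<Longrightarrow> br u (fscale x v) = fscale x (br u v)"
  and bracket_scale_left: "u \<in> V \<Longrightarrow> v \<in> V \<Longrightarrow> br (fscale x v) u = fscale x (br v u)"
  and bracket_self: "u \<in> V \<Longrightarrow> br u u = 0"
  and jacobi: "u \<in> V \<Longrightarrow> v \<in> V \<Longrightarrow> w \<in> V \<Longrightarrow> br u (br v w) + br v (br w u) + br w (br u v) = 0"
  using lie by (simp_all add: lie_algebra_def linear_on_def)

lemma bracket_diff_right: "u \<in> V \<Longrightarrow> v \<in> V \<Longrightarrow> w \<in> V \<Longrightarrow> br u (v - w) = br u v - br u w"
  using bracket_add_right[of u "v - w" w] by (simp add: eq_diff_eq)

lemma bracket_diff_left: "u \<in> V \<Longrightarrow> v \<in> V \<Longrightarrow> w \<in> V \<Longrightarrow> br (v - w) u = br v u - br w u"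
  using bracket_add_left[of u "v - w" w] by (simp add: eq_diff_eq)

lemma bracket_anti:
  assumes "u \<in> V" "v \<in> V"
  shows "br v u = - br u v"
proof -
  have "br v u + br u v = br (u + v) (u + v)"
    using assms bracket_self[of u] bracket_self[of v]
    by (simp add: bracket_add_left bracket_add_right add.commute)
  also have "\<dots> = 0" using assms by (intro bracket_self) simp
  finally have "br v u + br u v = 0" .
  then show ?thesis by (rule eq_neg_iff_add_eq_0[THEN iffD2])
qed

lemma bracket_minus_left: "u \<in> V \<Longrightarrow> v \<in> V \<Longrightarrow> br (- v) u = - br v u"
  using bracket_scale_left[of u v "-1"] by (simp flip: fscale_minus_one)

text \<open>The Jacobi identity as an expansion of the left-nested bracket, which suits rewriting
  better than the cyclic sum.\<close>

lemma bracket_derivation: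
  assumes "u \<in> V" "v \<in> V" "w \<in> V"
  shows "br (br u v) w = br (br u w) v + br u (br v w)"
proof -
  have "br v (br w u) = - br (br w u) v"
    by (rule bracket_anti) (use assms in simp_all)
  moreover have wu: "br w u = - br u w"
    by (rule bracket_anti) (use assms in simp_all)
  ultimately have 1: "br v (br w u) = br (br u w) v"
    using assms by (simp only: bracket_minus_left bracket_closed minus_minus)
  have 2: "br w (br u v) = - br (br u v) w"
    by (rule bracket_anti) (use assms in simp_all)
  show ?thesis using jacobi[OF assms] unfolding 1 2 by (simp add: algebra_simps)
qed

lemmas bracket_linear = bracket_add_left bracket_add_right bracket_scale_left bracket_scale_right
  bracket_diff_left bracket_diff_right

end

lemma (in lie_algebra_on) lie_coalgebra_dual:
  assumes "good_subspace V br G"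
  shows "lie_coalgebra G (dual_cobracket V br)"
proof -
  have G: "fun_space.subspace G" and GV: "G \<subseteq> dual_space V"
    and T: "\<And>f. f \<in> G \<Longrightarrow> dual_cobracket V br f \<in> tensor G G"
    using assms by (auto simp: good_subspace_def)
  have "linear_on G (dual_cobracket V br)"
    using GV by (auto simp: linear_on_def dual_cobracket_def fun_eq_iff)
  moreover have "\<exists>\<rho>\<in>tensor G G. dual_cobracket V br f = \<rho> - swap_tensor \<rho>" if f: "f \<in> G" for f
  proof -
    have fV: "f \<in> dual_space V" using f GV by blast
    have anti: "f (br v u) = - f (br u v)" if "u \<in> V" "v \<in> V" for u v
      by (subst bracket_anti[OF that]) (use that in \<open>simp add: dual_space_minus[OF fV]\<close>)
    show ?thesis
    proof (intro bexI)
      \<comment> \<open>\<open>f\<close> composed with the bracket is skew, so half of it is a valid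
        \<rho>: subtracting the flip adds the second half.\<close>
      show "fscale (1/2) (dual_cobracket V br f) \<in> tensor G G"
        by (intro fun_space.subspace_scale subspace_tensor T f)
      show "dual_cobracket V br f = fscale (1/2) (dual_cobracket V br f) -
          swap_tensor (fscale (1/2) (dual_cobracket V br f))"
      proof (rule ext, clarify)
        fix u v
        show "dual_cobracket V br f (u, v) = (fscale (1/2) (dual_cobracket V br f) -
            swap_tensor (fscale (1/2) (dual_cobracket V br f))) (u, v)"
          using anti[of v u] by (auto simp: dual_cobracket_def swap_tensor_def)
      qed
    qed
  qed
  moreover have "map_right (dual_cobracket V br) (dual_cobracket V br f) (s, (t, w)) +
      map_right (dual_cobracket V br) (dual_cobracket V br f) (t, (w, s)) +
      map_right (dual_cobracket V br) (dual_cobracket V br f) (w, (s, t)) =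
          0" if f: "f \<in> G" for f s t w
  proof (cases "s \<in> V \<and> t \<in> V \<and> w \<in> V")
    case True
    have fV: "f \<in> dual_space V" using f GV by blast
    \<comment> \<open>The co-Jacobi sum is \<open>f\<close> applied to the Jacobi sum.\<close>
    have "f (br s (br t w)) + f (br t (br w s)) + f (br w (br s t)) = f 0"
      using True by (simp add: jacobi flip: dual_space_add[OF fV])
    moreover have "f 0 = 0" using dual_space_add[OF fV, of 0 0] by simp
    ultimately show ?thesis
      using True by (simp add: map_right_def dual_cobracket_def)
  next
    case False
    then show ?thesis by (auto simp: map_right_def dual_cobracket_def)
  qed
  ultimately show ?thesis
    using G T by (simp add: lie_coalgebra_def)
qed

section \<open>The coboundary structure of the pair\<close>

locale triangular_pair = lie_algebra_on V br
  for V :: "('s \<Rightarrow> 'a::field_char_0) set" and br +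
  fixes a b :: "'s \<Rightarrow> 'a" and c :: 'a
  assumes a [simp]: "a \<in> V" and b [simp]: "b \<in> V" and ab: "br a b = fscale c b"
begin

definition r where "r = pure_tensor a b - pure_tensor b a"

definition \<delta> where "\<delta> u = tensor_act br u r"

lemma ba: "br b a = fscale (- c) b"
  using bracket_anti[of a b] by (auto simp: ab fun_eq_iff)

text \<open>Coordinates instead of tensors: each axiom for \<delta> becomes an identity between
  products of scalars, decided by ring normalisation once the brackets are in normal form.\<close>

lemma cobracket_apply:
  assumes "u \<in> V"
  shows "\<delta> u (s, t) = b t * br u a s - a t * br u b s + a s * br u b t - b s * br u a t"
proof -
  have "(\<lambda>s. r (s, t)) = fscale (b t) a - fscale (a t) b"
    "(\<lambda>t. r (s, t)) = fscale (a s) b - fscale (b s) a"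
    by (auto simp: r_def fun_eq_iff)
  then show ?thesis
    using assms by (simp add: \<delta>_def tensor_act_def map_left_def map_right_def bracket_linear)
qed

lemma cobracket_eq:
  assumes "u \<in> V"
  shows "\<delta> u = pure_tensor (br u a) b - pure_tensor (br u b) a + pure_tensor a (br u b) -
    pure_tensor b (br u a)"
  using cobracket_apply[OF assms] by (auto simp: fun_eq_iff mult.commute)

text \<open>The relation between \<open>a\<close> and \<open>b\<close>, transferred to an arbitrary
  \<open>u\<close>: right multiplications by \<open>a\<close> and \<open>b\<close> commute up to a
  multiple of the one by \<open>b\<close>. Read from left to right it gives nested brackets a normal
  form, on which co-Jacobi for \<delta> and the Jacobi identity of the dual rest.\<close>

lemma commute_with_pair:
  assumes "u \<in> V"
  shows "br (br u a) b = br (br u b) a + fscale c (br u b)"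
  using bracket_derivation[of u a b] assms by (simp add: ab bracket_linear)

lemma lie_coalgebra_cobracket: "lie_coalgebra V \<delta>"
proof -
  have T: "\<delta> u \<in> tensor V V" if "u \<in> V" for u
    using that by (auto simp: cobracket_eq
        intro!: fun_space.subspace_add fun_space.subspace_diff subspace_tensor
            pure_tensor_in_tensor)
  have "linear_on V \<delta>"
    by (auto simp: linear_on_def cobracket_apply fun_eq_iff bracket_linear algebra_simps)
  moreover have "\<exists>\<rho>\<in>tensor V V. \<delta> u = \<rho> - swap_tensor \<rho>" if "u \<in> V" for u
  proof
    \<comment> \<open>Two of the four terms of \<open>\<delta> u\<close>; the other two are their
      flips with opposite sign.\<close>
    show "\<delta> u = (pure_tensor (br u a) b + pure_tensor a (br u b)) -
        swap_tensor (pure_tensor (br u a) b + pure_tensor a (br u b))"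
      using that by (auto simp: cobracket_apply fun_eq_iff swap_tensor_def)
  qed (use that in \<open>auto intro!: fun_space.subspace_add subspace_tensor pure_tensor_in_tensor\<close>)
  moreover have "map_right \<delta> (\<delta> u) (s, (t, w)) + map_right \<delta> (\<delta> u) (t, (w, s)) +
      map_right \<delta> (\<delta> u) (w, (s, t)) = 0" if u: "u \<in> V" for u s t w
  proof -
    \<comment> \<open>Each row is a combination of \<open>a\<close>, \<open>b\<close>,
      \<open>br u a\<close> and \<open>br u b\<close>, hence an element of \<open>V\<close>, so the
      inner \<delta> can be expanded by \<open>cobracket_apply\<close> again.\<close>
    have "(\<lambda>t. \<delta> u (s, t)) = fscale (br u a s) b - fscale (br u b s) a + fscale (a s) (br u b) -
        fscale (b s) (br u a)" for s
      using u by (auto simp: cobracket_apply fun_eq_iff)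
    then have slice: "map_right \<delta> (\<delta> u) (s, (t, w)) =
        \<delta> (fscale (br u a s) b - fscale (br u b s) a + fscale (a s) (br u b) - fscale (b s)
            (br u a)) (t, w)" for s t w
      by (simp add: map_right_def)
    show ?thesis
      unfolding slice
      using u by (simp add: cobracket_apply bracket_linear ab ba bracket_self commute_with_pair
        algebra_simps)
  qed
  ultimately show ?thesis
    using T by (simp add: lie_coalgebra_def subspace)
qed

text \<open>Since \<open>\<delta> u\<close> is the action of \<open>u\<close> on \<open>r\<close>,
  compatibility says that this action respects brackets. That is the Jacobi identity in each tensor
  factor, applied with \<open>a\<close> and \<open>b\<close> as third argument.\<close>

lemma lie_bialgebra_cobracket: "lie_bialgebra V br \<delta>"
proof -
  have "\<delta> (br u v) = tensor_act br u (\<delta> v) - tensor_act br v (\<delta> u)" if uv: "u \<in> V" "v \<in> V" for u v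
  proof -
    have "(\<lambda>s. \<delta> v (s, t)) = fscale (b t) (br v a) - fscale (a t) (br v b) + fscale (br v b t) a -
          fscale (br v a t) b"
      "(\<lambda>s. \<delta> v (t, s)) = fscale (br v a t) b - fscale (br v b t) a + fscale (a t) (br v b) -
          fscale (b t) (br v a)" if "v \<in> V" for v t
      using that by (auto simp: cobracket_apply fun_eq_iff)
    note slices = this
    have J: "br u (br v z) = br v (br u z) + br (br u v) z" if "z \<in> V" for z
      using bracket_derivation[of u v z] bracket_anti[of v "br u z"] uv that
      by (simp add: algebra_simps)
    have act: "tensor_act br u (\<delta> v) (s, t) =
        b t * br u (br v a) s - a t * br u (br v b) s + br v b t * br u a s - br v a t * br u b s +
        (br v a s * br u b t - br v b s * br u a t + a s * br u (br v b) t - b s * br u (br v a) t)"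
      if "u \<in> V" "v \<in> V" for u v s t
      using that by (simp add: tensor_act_def map_left_def map_right_def slices bracket_linear)
    show ?thesis
      using uv by (auto simp: act cobracket_apply fun_eq_iff J algebra_simps)
  qed
  then show ?thesis
    by (simp add: lie_bialgebra_def lie lie_coalgebra_cobracket)
qed

end

subsection \<open>The classical Yang--Baxter equation\<close>

lemma word_mult_one_left [simp]: "word_mult word_one p = p"
proof
  fix xs
  have "(\<Sum>k\<le>length xs. word_one (take k xs) * p (drop k xs)) =
      (\<Sum>k\<in>{0}. word_one (take k xs) * p (drop k xs))"
    by (rule sum.mono_neutral_right) (auto simp: word_one_def)
  then show "word_mult word_one p xs = p xs"
    by (simp add: word_mult_def word_one_def)
qed

lemma word_mult_one_right [simp]: "word_mult p word_one = p"
proof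
  fix xs
  have "(\<Sum>k\<le>length xs. p (take k xs) * word_one (drop k xs)) =
      (\<Sum>k\<in>{length xs}. p (take k xs) * word_one (drop k xs))"
    by (rule sum.mono_neutral_right) (auto simp: word_one_def)
  then show "word_mult p word_one xs = p xs"
    by (simp add: word_mult_def word_one_def)
qed

lemma word_one_in_tensor_algebra: "word_one \<in> tensor_algebra V"
proof -
  have "word_one = foldr word_mult (map word_emb []) word_one" by simp
  moreover have "set [] \<subseteq> V" by simp
  ultimately show ?thesis unfolding tensor_algebra_def by (intro fun_space.span_base) blast
qed

lemma word_emb_in_tensor_algebra:
  assumes "v \<in> V"
  shows "word_emb v \<in> tensor_algebra V"
proof -
  have "word_emb v = foldr word_mult (map word_emb [v]) word_one" "set [v] \<subseteq> V"
    using assms by auto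
  then show ?thesis unfolding tensor_algebra_def by (intro fun_space.span_base) blast
qed

lemma enveloping_relation:
  assumes "u \<in> V" "v \<in> V"
  shows "word_mult (word_emb u) (word_emb v) - word_mult (word_emb v) (word_emb u) -
    word_emb (br u v) \<in> enveloping_ideal V br"
proof -
  have "word_mult (word_emb u) (word_emb v) - word_mult (word_emb v) (word_emb u) -
    word_emb (br u v) = word_mult word_one (word_mult (word_mult (word_emb u) (word_emb v) -
      word_mult (word_emb v) (word_emb u) - word_emb (br u v)) word_one)"
    by simp
  then show ?thesis unfolding enveloping_ideal_def
    using assms word_one_in_tensor_algebra by (intro fun_space.span_base) blast
qed

text \<open>Nested to the right as in \<open>enveloping_null3\<close>, so that membership there can
  be read off leg by leg.\<close>

definition pure_tensor3 where
  "pure_tensor3 p q s = pure_tensor p (pure_tensor q s)"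

lemma pure_tensor3_apply [simp]: "pure_tensor3 p q s (x, y, z) = p x * q y * s z"
  by (simp add: pure_tensor3_def mult.assoc)

lemma word_mult3_pure:
  fixes p :: "'s list \<Rightarrow> 'b::field"
  shows
  "word_mult3 (pure_tensor3 p q s) (pure_tensor3 p' q' s') =
    pure_tensor3 (word_mult p p') (word_mult q q') (word_mult s s')"
proof -
  have "(\<Sum>i\<in>I. \<Sum>j\<in>J. \<Sum>k\<in>L. f i * g j * h k * (f' i * g' j * h' k)) =
      (\<Sum>i\<in>I. f i * f' i) * (\<Sum>j\<in>J. g j * g' j) * (\<Sum>k\<in>L. h k * h' k)"
    for I J L :: "nat set" and f g h f' g' h' :: "nat \<Rightarrow> 'b"
  proof -
    have "(\<Sum>i\<in>I. \<Sum>j\<in>J. \<Sum>k\<in>L. f i * g j * h k * (f' i * g' j * h' k)) =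
      (\<Sum>i\<in>I. \<Sum>j\<in>J. \<Sum>k\<in>L. (f i * f' i) * (g j * g' j) * (h k * h' k))"
      by (simp add: mult_ac)
    then show ?thesis by (simp only: sum_distrib_left [symmetric] sum_distrib_right [symmetric])
  qed
  then show ?thesis
    by (auto simp: fun_eq_iff word_mult3_def word_mult_def)
qed

lemma word_mult3_diff_left: "word_mult3 (P - P') Q = word_mult3 P Q - word_mult3 P' Q"
  and word_mult3_diff_right: "word_mult3 P (Q - Q') = word_mult3 P Q - word_mult3 P Q'"
  by (simp_all add: fun_eq_iff word_mult3_def sum_subtractf left_diff_distrib right_diff_distrib)

lemma legs_pure:
  "leg12 (pure_tensor u v) = pure_tensor3 (word_emb u) (word_emb v) word_one"
  "leg13 (pure_tensor u v) = pure_tensor3 (word_emb u) word_one (word_emb v)"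
  "leg23 (pure_tensor u v) = pure_tensor3 word_one (word_emb u) (word_emb v)"
  by (simp_all add: fun_eq_iff leg12_def leg13_def leg23_def word_emb_def word_one_def)

lemma legs_diff:
  "leg12 (\<rho> - \<sigma>) = leg12 \<rho> - leg12 \<sigma>" "leg13 (\<rho> - \<sigma>) = leg13 \<rho> - leg13 \<sigma>"
  "leg23 (\<rho> - \<sigma>) = leg23 \<rho> - leg23 \<sigma>"
  by (auto simp: fun_eq_iff leg12_def leg13_def leg23_def)

context triangular_pair
begin

lemma CYBE: "CYBE V br r"
proof -
  define A where "A = word_emb a"
  define B where "B = word_emb b"
  \<comment> \<open>An element that is zero in the enveloping algebra, since \<open>br a b\<close>
    is \<open>fscale c b\<close>.\<close>
  define E where "E = word_mult A B - word_mult B A - fscale c B"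
  have "word_emb (fscale c b) = fscale c (word_emb b)"
    by (auto simp: fun_eq_iff word_emb_def)
  then have E: "E \<in> enveloping_ideal V br"
    using enveloping_relation[of a V b br] by (simp add: E_def A_def B_def ab)
  have A: "A \<in> tensor_algebra V" and B: "B \<in> tensor_algebra V"
    by (simp_all add: A_def B_def word_emb_in_tensor_algebra)
  have null: "pure_tensor3 E p q \<in> enveloping_null3 V br"
      "pure_tensor3 p E q \<in> enveloping_null3 V br"
      "pure_tensor3 p q E \<in> enveloping_null3 V br"
    if "p \<in> tensor_algebra V" "q \<in> tensor_algebra V" for p q
    unfolding enveloping_null3_def Let_def pure_tensor3_def
    by (rule fun_space.span_base, simp add: that E pure_tensor_in_tensor)+
  \<comment> \<open>Replacing each commutator of \<open>A\<close> and \<open>B\<close> by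
    \<open>E + fscale c B\<close> turns the three brackets into these six tensors; the terms with
    \<open>c\<close> cancel in pairs.\<close>
  have "commutator3 (leg12 r) (leg13 r) + commutator3 (leg12 r) (leg23 r)
       + commutator3 (leg13 r) (leg23 r) =
     (pure_tensor3 E A B - pure_tensor3 E B A) + (pure_tensor3 B E A - pure_tensor3 A E B) +
     (pure_tensor3 A B E - pure_tensor3 B A E)"
    by (auto simp: r_def commutator3_def legs_diff legs_pure word_mult3_diff_left
        word_mult3_diff_right word_mult3_pure E_def A_def [symmetric] B_def [symmetric] fun_eq_iff
            algebra_simps)
  also have "\<dots> \<in> enveloping_null3 V br"
    unfolding enveloping_null3_def Let_def
    by (intro fun_space.span_add fun_space.span_diff null[unfolded enveloping_null3_def Let_def] A
      B)
  finally show ?thesis by (simp add: CYBE_def)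
qed

lemma triangular_lie_bialgebra_pair: "triangular_lie_bialgebra V br \<delta> r"
  by (auto simp: triangular_lie_bialgebra_def coboundary_lie_bialgebra_def CYBE [unfolded r_def]
      lie_bialgebra_cobracket \<delta>_def r_def
      intro!: fun_space.subspace_diff subspace_tensor pure_tensor_in_tensor)

subsection \<open>The dual bialgebra\<close>

lemma dual_bracket_apply:
  assumes "f \<in> dual_space V" "g \<in> dual_space V" "u \<in> V"
  shows "dual_bracket V \<delta> f g u =
    g b * f (br u a) - g a * f (br u b) + f a * g (br u b) - f b * g (br u a)"
proof -
  have diff: "h (v - w) = h v - h w" if "h \<in> dual_space V" "v \<in> V" "w \<in> V" for h v w
    using dual_space_add[OF that(1) diff_closed[OF that(2,3)] that(3)] by simp
  note lin = dual_space_add[OF assms(1)] dual_space_add[OF assms(2)] dual_space_scale[OF assms(1)]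
    dual_space_scale[OF assms(2)] diff[OF assms(1)] diff[OF assms(2)]
  have "(\<lambda>s. \<delta> u (s, t)) = fscale (b t) (br u a) - fscale (a t) (br u b) + fscale (br u b t) a -
          fscale (br u a t) b" for t
    using assms by (auto simp: cobracket_apply fun_eq_iff)
  then have "f (\<lambda>s. \<delta> u (s, t)) = b t * f (br u a) - a t * f (br u b) + br u b t * f a - br u a t
      * f b" for t
    using assms by (simp add: lin)
  then have "(\<lambda>t. f (\<lambda>s. \<delta> u (s, t))) = fscale (f (br u a)) b - fscale (f (br u b)) a +
      fscale (f a) (br u b) -
     fscale (f b) (br u a)"
    by (auto simp: fun_eq_iff)
  then have "tensor_eval f g (\<delta> u) = g (fscale (f (br u a)) b - fscale (f (br u b)) a +
      fscale (f a) (br u b) -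
     fscale (f b) (br u a))"
    by (simp add: tensor_eval_def)
  then show ?thesis
    using assms by (simp add: dual_bracket_def lin)
qed

lemma lie_bialgebra_dual:
  assumes "good_subspace V br G"
  shows "lie_bialgebra G (dual_bracket V \<delta>) (dual_cobracket V br)"
proof -
  have G: "fun_space.subspace G" and GV: "G \<subseteq> dual_space V"
    and T: "\<And>f. f \<in> G \<Longrightarrow> dual_cobracket V br f \<in> tensor G G"
    using assms by (auto simp: good_subspace_def)
  \<comment> \<open>A slice of the cobracket of \<open>f\<close>, namely \<open>u\<close> going to
    \<open>f (br u v)\<close>; goodness of \<open>G\<close> puts it into \<open>G\<close>.\<close>
  define col where "col f v = (\<lambda>u. dual_cobracket V br f (u, v))" for f v
  have col: "col f v \<in> G" if "f \<in> G" for f v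
    unfolding col_def by (rule tensor_column[OF G T[OF that]])
  have col_apply: "col f v u = f (br u v)" if "u \<in> V" "v \<in> V" for f u v
    using that by (simp add: col_def dual_cobracket_def)
  have f_lin: "v \<in> V \<Longrightarrow> w \<in> V \<Longrightarrow> f (v + w) = f v + f w"
      "v \<in> V \<Longrightarrow> w \<in> V \<Longrightarrow> f (v - w) = f v - f w"
      "v \<in> V \<Longrightarrow> f (fscale x v) = x * f v" "v \<in> V \<Longrightarrow> f (- v) = - f v" "f 0 = 0"
    if "f \<in> G" for f v w x
  proof -
    have f: "f \<in> dual_space V" using that GV by blast
    show "v \<in> V \<Longrightarrow> w \<in> V \<Longrightarrow> f (v + w) = f v + f w" "v \<in> V \<Longrightarrow> f (fscale x v) = x * f v"
      by (simp_all add: dual_space_add[OF f] dual_space_scale[OF f])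
    show "v \<in> V \<Longrightarrow> w \<in> V \<Longrightarrow> f (v - w) = f v - f w"
      using dual_space_add[OF f, of "v - w" w] by simp
    show "v \<in> V \<Longrightarrow> f (- v) = - f v" by (rule dual_space_minus[OF f])
    show "f 0 = 0" using dual_space_add[OF f, of 0 0] by simp
  qed
  have ev: "dual_bracket V \<delta> f g u = g b * f (br u a) - g a * f (br u b) + f a * g (br u b) - f b
      * g (br u a)"
    if "f \<in> G" "g \<in> G" "u \<in> V" for f g u
    using that GV by (intro dual_bracket_apply) auto
  have outside: "dual_bracket V \<delta> f g u = 0" if "u \<notin> V" for f g u
    using that by (simp add: dual_bracket_def)
  have closed: "dual_bracket V \<delta> f g \<in> G" if "f \<in> G" "g \<in> G" for f g
  proof -
    \<comment> \<open>The dual bracket sees \<open>f\<close> and \<open>g\<close> only through their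
      values and their slices at \<open>a\<close> and \<open>b\<close>, so it stays in
      \<open>G\<close>.\<close>
    have "dual_bracket V \<delta> f g = fscale (g b) (col f a) - fscale (g a) (col f b) +
       fscale (f a) (col g b) - fscale (f b) (col g a)"
    proof
      fix u show "dual_bracket V \<delta> f g u = (fscale (g b) (col f a) - fscale (g a) (col f b) +
       fscale (f a) (col g b) - fscale (f b) (col g a)) u"
        using that by (cases "u \<in> V") (auto simp: ev outside col_apply, simp add: col_def
          dual_cobracket_def)
    qed
    then show ?thesis
      using that by (simp add: col G fun_space.subspace_add fun_space.subspace_diff
        fun_space.subspace_scale)
  qed
  have add: "f + g \<in> G" if "f \<in> G" "g \<in> G" for f g
    using that G by (simp add: fun_space.subspace_add)
  have scale: "fscale x f \<in> G" if "f \<in> G" for f x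
    using that G by (simp add: fun_space.subspace_scale)
  have neg: "- f \<in> G" if "f \<in> G" for f
    using that G by (simp add: fun_space.subspace_neg)
  have ext_on: "\<phi> = \<psi>" if "\<And>u. u \<in> V \<Longrightarrow> \<phi> u = \<psi> u" "\<And>u. u \<notin> V \<Longrightarrow> \<phi> u = \<psi> u"
    for \<phi> \<psi> :: "('s \<Rightarrow> 'a) \<Rightarrow> 'a" using that by (meson ext)
  have vanish: "f u = 0" if "f \<in> G" "u \<notin> V" for f u
    using that GV by (auto simp: dual_space_outside)
  have "lie_algebra G (dual_bracket V \<delta>)"
    unfolding lie_algebra_def linear_on_def
  proof (intro conjI ballI allI G)
    fix f g h x assume f: "f \<in> G" and g: "g \<in> G" and h: "h \<in> G"
    note fgh = f g h
    show "dual_bracket V \<delta> f g \<in> G" by (rule closed) fact+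
    show "dual_bracket V \<delta> h (f + g) = dual_bracket V \<delta> h f + dual_bracket V \<delta> h g"
      using fgh by (intro ext_on) (auto simp: ev add outside algebra_simps)
    show "dual_bracket V \<delta> (f + g) h = dual_bracket V \<delta> f h + dual_bracket V \<delta> g h"
      using fgh by (intro ext_on) (auto simp: ev add outside algebra_simps)
    show "dual_bracket V \<delta> h (fscale x f) = fscale x (dual_bracket V \<delta> h f)"
      using fgh by (intro ext_on) (auto simp: ev scale outside algebra_simps)
    show "dual_bracket V \<delta> (fscale x f) h = fscale x (dual_bracket V \<delta> f h)"
      using fgh by (intro ext_on) (auto simp: ev scale outside algebra_simps)
    show "dual_bracket V \<delta> f f = 0"
      using fgh by (intro ext_on) (auto simp: ev outside algebra_simps)
    show "dual_bracket V \<delta> f (dual_bracket V \<delta> g h) + dual_bracket V \<delta> g (dual_bracket V \<delta> h f) +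
        dual_bracket V \<delta> h (dual_bracket V \<delta> f g) = 0"
    proof (rule ext_on)
      fix u assume u: "u \<in> V"
      \<comment> \<open>At a fixed \<open>u\<close> the double brackets are values of
        \<open>f\<close>, \<open>g\<close>, \<open>h\<close> at \<open>a\<close>, \<open>b\<close>
        and at brackets with them; \<open>commute_with_pair\<close> identifies the two mixed
        nestings, and the rest cancels.\<close>
      show "(dual_bracket V \<delta> f (dual_bracket V \<delta> g h) + dual_bracket V \<delta> g (dual_bracket V \<delta> h f) +
        dual_bracket V \<delta> h (dual_bracket V \<delta> f g)) u = 0 u"
        using fgh u
        by (simp add: ev closed ab ba bracket_self bracket_linear f_lin[OF f] f_lin[OF g] f_lin[OF
          h] commute_with_pair algebra_simps)
    qed (simp add: outside)
  qed
  moreover have "dual_cobracket V br (dual_bracket V \<delta> f g) =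
      tensor_act (dual_bracket V \<delta>) f (dual_cobracket V br g) -
      tensor_act (dual_bracket V \<delta>) g (dual_cobracket V br f)" if f: "f \<in> G" and g: "g \<in> G" for f g
  proof -
    \<comment> \<open>\<open>tensor_act\<close> also uses the slices in the other argument; by
      skew-symmetry they are the negated columns.\<close>
    have rows: "(\<lambda>v. dual_cobracket V br f (u, v)) = - (col f u)" if "f \<in> G" for f u
    proof (rule ext)
      fix v show "dual_cobracket V br f (u, v) = (- col f u) v"
        using bracket_anti[of v u] f_lin(4)[OF that, of "br v u"]
        by (auto simp: col_def dual_cobracket_def)
    qed
    note fg = f g
    have "dual_cobracket V br (dual_bracket V \<delta> f g) (u, v) =
      dual_bracket V \<delta> f (col g v) u + dual_bracket V \<delta> f (- (col g u)) v -
      (dual_bracket V \<delta> g (col f v) u + dual_bracket V \<delta> g (- (col f u)) v)" for u v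
    proof (cases "u \<in> V \<and> v \<in> V")
      case False
      have z: "col f v = 0" if "v \<notin> V" for f v using that by (auto simp: col_def dual_cobracket_def)
      have G0: "0 \<in> G" by (rule fun_space.subspace_0[OF G])
      have z': "dual_bracket V \<delta> f 0 w = 0" if "f \<in> G" for f w
        using that by (cases "w \<in> V") (simp_all add: ev outside G0)
      show ?thesis
        using False z'[OF f] z'[OF g] by (auto simp: dual_cobracket_def z outside)
    next
      case True
      then have u: "u \<in> V" and v: "v \<in> V" by auto
      \<comment> \<open>Splits the argument \<open>br u v\<close> so that, for \<open>z\<close>
        equal to \<open>a\<close> or \<open>b\<close>, only values of the columns at
        \<open>u\<close> and \<open>v\<close> remain.\<close>
      have d: "br (br u v) z = br (br u z) v - br (br v z) u" if "z \<in> V" for z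
        using bracket_derivation[OF u v that] bracket_anti[OF bracket_closed[OF v that] u] by simp
      have an: "f (br a u) = - f (br u a)" "f (br b u) = - f (br u b)" if "f \<in> G" "u \<in> V" for f u
        using that by (simp_all add: bracket_anti[of u a] bracket_anti[of u b] f_lin(4)[OF that(1)])
      show ?thesis
        using u v fg by (simp add: neg dual_cobracket_def ev col scale col_apply d f_lin[OF f]
          f_lin[OF g] an[OF f] an[OF g] algebra_simps)
    qed
    then show ?thesis
      by (auto simp: fun_eq_iff tensor_act_def map_left_def map_right_def rows fg col_def
        [symmetric])
  qed
  ultimately show ?thesis
    by (simp add: lie_bialgebra_def lie_coalgebra_dual[OF assms])
qed

end

section \<open>The Witt and Virasoro algebras\<close>

lemma finite_support_add:
  "finite {b. u b \<noteq> 0} \<Longrightarrow> finite {b. v b \<noteq> 0} \<Longrightarrow> finite {b. (u + v) b \<noteq> (0::'a::field)}"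
  by (rule finite_subset[of _ "{b. u b \<noteq> 0} \<union> {b. v b \<noteq> 0}"]) auto

lemma finite_support_scale: "finite {b. u b \<noteq> 0} \<Longrightarrow> finite {b. fscale c u b \<noteq> 0}"
  by (rule finite_subset[of _ "{b. u b \<noteq> 0}"]) auto

lemma finite_support_unit_vector [simp]: "finite {b. unit_vector b' b \<noteq> 0}"
  by (rule finite_subset[of _ "{b'}"]) (auto simp: unit_vector_def)

lemma subspace_witt_space: "fun_space.subspace (witt_space K)"
proof (rule fun_space.subspaceI)
  fix u v :: "witt_index \<Rightarrow> 'a" and c
  assume "u \<in> witt_space K" "v \<in> witt_space K"
  moreover have "{b. (u + v) b \<noteq> 0} \<subseteq> {b. u b \<noteq> 0} \<union> {b. v b \<noteq> 0}"
      "{b. fscale c u b \<noteq> 0} \<subseteq> {b. u b \<noteq> 0}"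
    by auto
  ultimately show "u + v \<in> witt_space K" "fscale c u \<in> witt_space K"
    using finite_support_add[of u v] finite_support_scale[of u c] by (auto simp: witt_space_def)
qed (simp add: witt_space_def)

lemma finite_support_witt_space: "u \<in> witt_space K \<Longrightarrow> finite {b. u b \<noteq> 0}"
  by (simp add: witt_space_def)

lemma unit_vector_in_witt_space [simp]: "unit_vector b \<in> witt_space K \<longleftrightarrow> b \<in> witt_basis K"
  by (auto simp: witt_space_def unit_vector_def)

lemma fscale_zero [simp]: "fscale 0 u = 0"
  by (simp add: fun_eq_iff)

lemma witt_space_induct [consumes 1, case_names zero step]:
  assumes "u \<in> witt_space K" and "P 0"
    and "\<And>c b u. b \<in> witt_basis K \<Longrightarrow> u \<in> witt_space K \<Longrightarrow> P u \<Longrightarrow> P (fscale c (unit_vector b) + u)"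
  shows "P u"
proof -
  have "u \<in> witt_space K \<Longrightarrow> {b. u b \<noteq> 0} \<subseteq> S \<Longrightarrow> P u" if "finite S" for S u
    using that
  proof (induction S arbitrary: u rule: finite_induct)
    case empty
    then have "u = 0" by auto
    then show ?case using assms(2) by (simp only:)
  next
    case (insert b S)
    define v where "v = u(b := 0)"
    have u: "u = fscale (u b) (unit_vector b) + v"
      by (auto simp: v_def unit_vector_def fun_eq_iff)
    have "{x. v x \<noteq> 0} \<subseteq> {x. u x \<noteq> 0}" "{x. v x \<noteq> 0} \<subseteq> S" using insert.prems(2)
        by (auto simp: v_def)
    moreover from this have v: "v \<in> witt_space K"
      using insert.prems(1) by (auto simp: witt_space_def intro: finite_subset)
    ultimately have "P v" by (intro insert.IH)
    show ?case
    proof (cases "u b = 0")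
      case True
      then have "u = v" using u by (simp)
      then show ?thesis using \<open>P v\<close> by simp
    next
      case False
      then have "b \<in> witt_basis K" using insert.prems(1) by (auto simp: witt_space_def)
      then show ?thesis using assms(3)[OF _ v \<open>P v\<close>, of b "u b"] u by simp
    qed
  qed
  then show ?thesis using assms(1) finite_support_witt_space by blast
qed

text \<open>The defining sum runs over the supports, which change when vectors are added; a common
  larger index set makes bilinearity a termwise statement.\<close>

lemma witt_bracket_superset:
  assumes "finite S" "finite T" "{b. u b \<noteq> 0} \<subseteq> S" "{b. v b \<noteq> 0} \<subseteq> T"
  shows "witt_bracket K u v = (\<Sum>b\<in>S. \<Sum>b'\<in>T. fscale (u b * v b') (basis_bracket K b b'))"
proof -
  have "(\<Sum>b'\<in>T. fscale (u b * v b') (basis_bracket K b b')) =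
      (\<Sum>b' | v b' \<noteq> 0. fscale (u b * v b') (basis_bracket K b b'))" for b
    by (rule sum.mono_neutral_right) (use assms in auto)
  moreover have "(\<Sum>b\<in>S. \<Sum>b' | v b' \<noteq> 0. fscale (u b * v b') (basis_bracket K b b')) =
      witt_bracket K u v"
    unfolding witt_bracket_def by (rule sum.mono_neutral_right) (use assms in auto)
  ultimately show ?thesis by simp
qed

lemma witt_bracket_add:
  assumes "finite {b. u b \<noteq> 0}" "finite {b. v b \<noteq> 0}" "finite {b. w b \<noteq> 0}"
  shows "witt_bracket K (u + v) w = witt_bracket K u w + witt_bracket K v w"
    and "witt_bracket K w (u + v) = witt_bracket K w u + witt_bracket K w v"
proof -
  define S where "S = {b. u b \<noteq> 0} \<union> {b. v b \<noteq> 0} \<union> {b. w b \<noteq> 0}"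
  have S: "finite S" "{b. u b \<noteq> 0} \<subseteq> S" "{b. v b \<noteq> 0} \<subseteq> S" "{b. w b \<noteq> 0} \<subseteq> S"
      "{b. (u + v) b \<noteq> 0} \<subseteq> S"
    using assms by (auto simp: S_def)
  show "witt_bracket K (u + v) w = witt_bracket K u w + witt_bracket K v w"
    using S by (simp add: witt_bracket_superset[of S S] distrib_right fun_space.scale_left_distrib
      sum.distrib)
  show "witt_bracket K w (u + v) = witt_bracket K w u + witt_bracket K w v"
    using S by (simp add: witt_bracket_superset[of S S] distrib_left fun_space.scale_left_distrib
      sum.distrib)
qed

lemma witt_bracket_scale:
  assumes "finite {b. u b \<noteq> 0}" "finite {b. w b \<noteq> 0}"
  shows "witt_bracket K (fscale c u) w = fscale c (witt_bracket K u w)"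
    and "witt_bracket K w (fscale c u) = fscale c (witt_bracket K w u)"
proof -
  define S where "S = {b. u b \<noteq> 0} \<union> {b. w b \<noteq> 0}"
  have S: "finite S" "{b. u b \<noteq> 0} \<subseteq> S" "{b. w b \<noteq> 0} \<subseteq> S" "{b. fscale c u b \<noteq> 0} \<subseteq> S"
    using assms by (auto simp: S_def)
  show "witt_bracket K (fscale c u) w = fscale c (witt_bracket K u w)"
    using S by (simp add: witt_bracket_superset[of S S] fun_space.scale_sum_right mult.assoc)
  show "witt_bracket K w (fscale c u) = fscale c (witt_bracket K w u)"
    using S by (simp add: witt_bracket_superset[of S S] fun_space.scale_sum_right mult_ac)
qed

lemma witt_bracket_zero [simp]: "witt_bracket K 0 u = 0" "witt_bracket K u 0 = 0"
  by (simp_all add: witt_bracket_def)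

lemma witt_bracket_unit_vector [simp]:
  "witt_bracket K (unit_vector b) (unit_vector b') = basis_bracket K b b'"
  by (subst witt_bracket_superset[of "{b}" "{b'}"]) (auto simp: unit_vector_def)

lemma basis_bracket_in_witt_space:
  assumes "b \<in> witt_basis K" "b' \<in> witt_basis K"
  shows "basis_bracket K b b' \<in> witt_space K"
proof (cases b; cases b')
  fix i j assume b: "b = Pow i" "b' = Pow j"
  show ?thesis
  \<comment> \<open>In the one-sided algebra \<open>i = j = 0\<close> would produce the exponent -1,
    but there the coefficient \<open>j - i\<close> vanishes; distinct nonnegative exponents have sum
    at least 1.\<close>
  proof (cases "i = j")
    case True
    with b show ?thesis
      by (auto intro!: fun_space.subspace_scale fun_space.subspace_add subspace_witt_space
          simp: witt_basis_def fun_space.subspace_0[OF subspace_witt_space])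
  next
    case False
    then have "Pow (i + j - 1) \<in> witt_basis K"
      using assms b by (auto simp: witt_basis_def exponents_def split: if_splits)
    with b show ?thesis
      by (auto intro!: fun_space.subspace_scale fun_space.subspace_add subspace_witt_space
          simp: witt_basis_def)
  qed
qed (auto simp: fun_space.subspace_0[OF subspace_witt_space])

lemma witt_bracket_in_witt_space:
  assumes "u \<in> witt_space K" "v \<in> witt_space K"
  shows "witt_bracket K u v \<in> witt_space K"
  unfolding witt_bracket_def
  by (intro fun_space.subspace_sum fun_space.subspace_scale subspace_witt_space
      basis_bracket_in_witt_space) (use assms in \<open>auto simp: witt_space_def\<close>)

section \<open>Skew-symmetry and the Jacobi identity\<close>

lemma basis_bracket_anti: "basis_bracket K b' b = - (basis_bracket K b b' :: _ \<Rightarrow> 'a::field_char_0)"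
proof (cases b; cases b')
  fix i j assume b: "b = Pow i" "b' = Pow j"
  \<comment> \<open>The cocycle is odd in \<open>i - 1\<close>, and on its antidiagonal
    \<open>j - 1\<close> is the negative of \<open>i - 1\<close>.\<close>
  have "of_int ((j - 1) ^ 3 - (j - 1)) = - (of_int ((i - 1) ^ 3 - (i - 1)) :: 'a)"
      if "i - 1 + (j - 1) = 0"
  proof -
    have j: "j = 2 - i" using that by simp
    have "(j - 1) ^ 3 - (j - 1) = - ((i - 1) ^ 3 - (i - 1))" unfolding j
        by (simp add: power3_eq_cube algebra_simps)
    then show ?thesis by (metis of_int_minus)
  qed
  then have central: "(if K = Virasoro \<and> j - 1 + (i - 1) = 0
        then fscale (of_int ((j - 1) ^ 3 - (j - 1)) / 12) (unit_vector Central) else 0) =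
      - (if K = Virasoro \<and> i - 1 + (j - 1) = 0
        then fscale (of_int ((i - 1) ^ 3 - (i - 1)) / 12) (unit_vector Central) else (0 :: _ \<Rightarrow> 'a))"
    by (auto simp: fun_eq_iff simp del: of_int_diff of_int_power)
  have "fscale (of_int (i - j)) (xpow (j + i - 1)) = - fscale (of_int (j - i)) (xpow (i +
      j - 1) :: _ \<Rightarrow> 'a)"
    by (simp add: fun_eq_iff algebra_simps)
  then show ?thesis
    unfolding b basis_bracket.simps central by simp
qed auto

lemma witt_bracket_self:
  assumes "finite {b. u b \<noteq> 0}"
  shows "witt_bracket K u u = 0"
proof -
  let ?S = "{b. u b \<noteq> 0}"
  \<comment> \<open>Exchanging the two summation indices shows the value to be its own negative,
    hence 0 in characteristic zero.\<close>
  have "witt_bracket K u u x = - witt_bracket K u u x" for x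
  proof -
    have "witt_bracket K u u x = (\<Sum>b\<in>?S. \<Sum>b'\<in>?S. u b * u b' * basis_bracket K b b' x)"
      by (simp add: witt_bracket_def sum_fun_apply)
    also have "\<dots> = (\<Sum>b\<in>?S. \<Sum>b'\<in>?S. u b' * u b * basis_bracket K b' b x)"
      by (rule sum.swap)
    also have "\<dots> = - (\<Sum>b\<in>?S. \<Sum>b'\<in>?S. u b * u b' * basis_bracket K b b' x)"
      unfolding sum_negf [symmetric]
      by (intro sum.cong refl, subst basis_bracket_anti) (simp add: mult_ac)
    also have "(\<Sum>b\<in>?S. \<Sum>b'\<in>?S. u b * u b' * basis_bracket K b b' x) = witt_bracket K u u x"
      by (simp add: witt_bracket_def sum_fun_apply)
    finally show ?thesis .
  qed
  then show ?thesis by (simp add: fun_eq_iff)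
qed

lemma basis_bracket_finite_support: "finite {x. basis_bracket K b b' x \<noteq> 0}"
proof (cases b; cases b')
  fix i j assume b: "b = Pow i" "b' = Pow j"
  show ?thesis
    by (rule finite_subset[of _ "{Pow (i + j - 1), Central}"])
      (auto simp: b unit_vector_def split: if_splits)
qed auto

lemma witt_bracket_finite_support:
  assumes "finite {b. u b \<noteq> 0}" "finite {b. v b \<noteq> 0}"
  shows "finite {x. witt_bracket K u v x \<noteq> 0}"
proof (rule finite_subset)
  show "{x. witt_bracket K u v x \<noteq> 0} \<subseteq> (\<Union>b\<in>{b. u b \<noteq> 0}. \<Union>b'\<in>{b. v b \<noteq> 0}. {x. basis_bracket K b
      b' x \<noteq> (0::'a)})"
  proof
    fix x assume "x \<in> {x. witt_bracket K u v x \<noteq> 0}"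
    then have "(\<Sum>b | u b \<noteq> 0. \<Sum>b' | v b' \<noteq> 0. u b * v b' * basis_bracket K b b' x) \<noteq> 0"
      by (simp add: witt_bracket_def sum_fun_apply)
    then obtain b where b: "u b \<noteq> 0" "(\<Sum>b' | v b' \<noteq> 0. u b * v b' * basis_bracket K b b' x) \<noteq> 0"
      using sum.not_neutral_contains_not_neutral by blast
    from b(2) obtain b' where "v b' \<noteq> 0" "u b * v b' * basis_bracket K b b' x \<noteq> 0"
      using sum.not_neutral_contains_not_neutral by blast
    then show "x \<in> (\<Union>b\<in>{b. u b \<noteq> 0}. \<Union>b'\<in>{b. v b \<noteq> 0}. {x. basis_bracket K b b' x \<noteq> (0::'a)})"
        using b by auto
  qed
qed (use assms in \<open>auto intro!: basis_bracket_finite_support\<close>)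

text \<open>The outer bracket kills the central part of the inner one, so a cocycle term can only
  come from outside; its condition (i - 1) + (j + k - 2) = 0 is i + j + k = 3.\<close>

lemma witt_bracket_nested:
  "witt_bracket K (xpow i) (basis_bracket K (Pow j) (Pow k)) =
    fscale (of_int ((k - j) * (j + k - 1 - i))) (xpow (i + j + k - 2)) +
    (if K = Virasoro \<and> i + j + k = 3
     then fscale (of_int ((k - j) * ((i - 1) ^ 3 - (i - 1))) / 12) (unit_vector Central) else
         (0 :: _ \<Rightarrow> 'a::field_char_0))"
proof -
  have "witt_bracket K (xpow i) (basis_bracket K (Pow j) (Pow k) :: _ \<Rightarrow> 'a) =
      fscale (of_int (k - j)) (basis_bracket K (Pow i) (Pow (j + k - 1)))"
    by (simp add: witt_bracket_add witt_bracket_scale finite_support_add finite_support_scale del: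
      basis_bracket.simps(1))
      (simp add: witt_bracket_add witt_bracket_scale finite_support_add finite_support_scale)
  also have "\<dots> = fscale (of_int ((k - j) * (j + k - 1 - i))) (xpow (i + j + k - 2)) +
    (if K = Virasoro \<and> i + j + k = 3
     then fscale (of_int ((k - j) * ((i - 1) ^ 3 - (i - 1))) / 12) (unit_vector Central) else 0)"
  proof -
    have "i + (j + k - 1) - 1 = i + j + k - 2" "i - 1 + (j + k - 1 - 1) = 0 \<longleftrightarrow> i + j + k = 3" by auto
    then show ?thesis
      unfolding basis_bracket.simps
      by (auto simp: fun_eq_iff distrib_left mult.assoc add.assoc simp del: of_int_diff
        of_int_power of_int_add)
  qed
  finally show ?thesis .
qed

lemma witt_jacobi_basis:
  "witt_bracket K (unit_vector b1) (basis_bracket K b2 b3) + witt_bracket K (unit_vector b2)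
      (basis_bracket K b3 b1) +
    witt_bracket K (unit_vector b3) (basis_bracket K b1 b2) = (0 :: _ \<Rightarrow> 'a::field_char_0)"
proof (cases "\<exists>i j k. b1 = Pow i \<and> b2 = Pow j \<and> b3 = Pow k")
  case True
  then obtain i j k where b: "b1 = Pow i" "b2 = Pow j" "b3 = Pow k" by blast
  have s: "j + k + i - 2 = i + j + k - 2" "k + i + j - 2 = i + j + k - 2"
    "j + k + i = 3 \<longleftrightarrow> i + j + k = 3" "k + i + j = 3 \<longleftrightarrow> i + j + k = 3" by auto
  have e: "(k - j) * (j + k - 1 - i) + (i - k) * (k + i - 1 - j) + (j - i) * (i + j - 1 - k) = 0"
    by (simp add: algebra_simps)
  \<comment> \<open>The 2-cocycle identity, a polynomial identity on the plane i + j + k =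
    3.\<close>
  have z: "(k - j) * ((i - 1) ^ 3 - (i - 1)) + (i - k) * ((j - 1) ^ 3 - (j - 1)) + (j - i) * ((k -
      1) ^ 3 - (k - 1)) = 0"
    if "i + j + k = 3"
  proof -
    have k: "k = 3 - i - j" using that by simp
    show ?thesis unfolding k by (simp add: power3_eq_cube algebra_simps)
  qed
  have e': "of_int ((k - j) * (j + k - 1 - i)) + of_int ((i - k) * (k + i - 1 - j)) +
      of_int ((j - i) * (i + j - 1 - k)) = (0::'a)"
    using arg_cong[OF e, of "of_int :: int \<Rightarrow> 'a"] by (simp only: of_int_add of_int_0)
  have z': "of_int ((k - j) * ((i - 1) ^ 3 - (i - 1))) + of_int ((i - k) * ((j - 1) ^ 3 - (j -
      1))) +
      of_int ((j - i) * ((k - 1) ^ 3 - (k - 1))) = (0::'a)" if "i + j + k = 3"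
    using arg_cong[OF z[OF that], of "of_int :: int \<Rightarrow> 'a"] by (simp only: of_int_add of_int_0)
  have comb: "fscale p X + (if Q then fscale (p' / 12) Y else 0) + (fscale q X + (if Q then fscale
      (q' / 12) Y else 0)) +
      (fscale t X + (if Q then fscale (t' / 12) Y else 0)) = 0"
    if "p + q + t = 0" "Q \<Longrightarrow> p' + q' + t' = 0" for p q t p' q' t' :: 'a
        and X Y :: "witt_index \<Rightarrow> 'a" and Q
  proof -
    have t: "t = - p - q" using that(1) by (simp add: eq_neg_iff_add_eq_0 algebra_simps)
    have t': "t' = - p' - q'" if Q using \<open>Q \<Longrightarrow> _\<close>[OF that]
        by (simp add: eq_neg_iff_add_eq_0 algebra_simps)
    show ?thesis
      by (cases Q) (simp_all add: t t' fun_eq_iff field_simps)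
  qed
  show ?thesis
    unfolding b witt_bracket_nested s
    by (rule comb[OF e' z']) auto
next
  case False
  then show ?thesis
    by (cases b1; cases b2; cases b3) (auto simp: witt_bracket_add witt_bracket_scale
      finite_support_add finite_support_scale)
qed

lemma lie_algebra_witt: "lie_algebra (witt_space K) (witt_bracket K)"
proof -
  note fin = finite_support_witt_space
  let ?br = "witt_bracket K"
  define J where "J u v w = ?br u (?br v w) + ?br v (?br w u) + ?br w (?br u v)"
      for u v w :: "witt_index \<Rightarrow> 'a"
  have J_linear: "J (fscale c x + u) v w = fscale c (J x v w) + J u v w"
    if "x \<in> witt_space K" "u \<in> witt_space K" "v \<in> witt_space K" "w \<in> witt_space K" for c x u v w
    using that[THEN fin]
    by (simp add: J_def witt_bracket_add witt_bracket_scale witt_bracket_finite_support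
      finite_support_add finite_support_scale
        fun_space.scale_right_distrib)
  \<comment> \<open>Cyclic invariance of the Jacobi sum transfers linearity from the first argument
    to the others.\<close>
  have J_cyclic: "J u v w = J v w u" for u v w
    by (simp only: J_def ac_simps)
  have J_linear2: "J v (fscale c x + u) w = fscale c (J v x w) + J v u w"
    and J_linear3: "J v w (fscale c x + u) = fscale c (J v w x) + J v w u"
    if "x \<in> witt_space K" "u \<in> witt_space K" "v \<in> witt_space K" "w \<in> witt_space K" for c x u v w
    using J_linear[OF that(1,2,4,3)] J_linear[OF that(1,2,3,4)] by (metis J_cyclic)+
  have J_zero: "J 0 v w = 0" "J v 0 w = 0" "J v w 0 = 0" for v w
    by (simp_all only: J_def witt_bracket_zero add_0_left)
  have "J u v w = 0" if u: "u \<in> witt_space K" and v: "v \<in> witt_space K" and w: "w \<in> witt_space K"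
      for u v w
    using u
  proof (induction rule: witt_space_induct)
    case (step c b u)
    have b: "unit_vector b \<in> witt_space K" using step by simp
    have "J (unit_vector b) v w = 0"
      using v
    proof (induction rule: witt_space_induct)
      case (step c' b' v)
      have b': "unit_vector b' \<in> witt_space K" using step by simp
      have "J (unit_vector b) (unit_vector b') w = 0"
        using w
      proof (induction rule: witt_space_induct)
        case (step c'' b'' w)
        have "J (unit_vector b) (unit_vector b') (unit_vector b'') = 0"
          unfolding J_def witt_bracket_unit_vector by (rule witt_jacobi_basis)
        moreover have "unit_vector b'' \<in> witt_space K" using step by simp
        ultimately show ?case
          by (subst J_linear3[OF _ step(2) b b'])
            (assumption, simp only: step(3) fun_space.scale_zero_right add_0_left)
      qed (rule J_zero)
      then show ?case
        by (subst J_linear2[OF b' step(2) b w]) (simp only: step(3) fun_space.scale_zero_right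
          add_0_left)
    qed (rule J_zero)
    then show ?case
      by (subst J_linear[OF b step(2) v w]) (simp only: step(3) fun_space.scale_zero_right
        add_0_left)
  qed (rule J_zero)
  moreover have "linear_on (witt_space K) (?br u)" "linear_on (witt_space K) (\<lambda>v. ?br v u)"
    if "u \<in> witt_space K" for u
    unfolding linear_on_def using that
    by (blast intro: witt_bracket_add witt_bracket_scale fin)+
  ultimately show ?thesis
    unfolding lie_algebra_def J_def
    by (blast intro: subspace_witt_space witt_bracket_in_witt_space witt_bracket_self fin)
qed

section \<open>Linear recurrences\<close>

text \<open>With \<open>F\<close> read as the functional taking x^j to \<open>F j\<close>, this is
  its value at x^i times \<open>g\<close>; x itself acts as the shift.\<close>

definition act :: "'a::comm_ring_1 poly \<Rightarrow> (int \<Rightarrow> 'a) \<Rightarrow> int \<Rightarrow> 'a" where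
  "act g F i = (\<Sum>k\<le>degree g. coeff g k * F (i + int k))"

lemma act_bound:
  assumes "degree g \<le> N"
  shows "act g F i = (\<Sum>k\<le>N. coeff g k * F (i + int k))"
  unfolding act_def using assms
  by (intro sum.mono_neutral_left) (auto simp: coeff_eq_0)

lemma act_pCons [simp]: "act (pCons a p) F i = a * F i + act p F (i + 1)"
proof -
  have "act (pCons a p) F i = (\<Sum>k\<le>Suc (degree p). coeff (pCons a p) k * F (i + int k))"
    by (rule act_bound) (simp add: degree_pCons_le)
  also have "\<dots> = a * F i + (\<Sum>k\<le>degree p. coeff p k * F (i + 1 + int k))"
    unfolding sum.atMost_Suc_shift by (simp add: algebra_simps)
  finally show ?thesis by (simp add: act_def)
qed

lemma act_0 [simp]: "act 0 F i = 0"
  by (simp add: act_def)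

lemma act_add: "act (p + q) F i = act p F i + act q F i"
  by (induction p q arbitrary: i rule: poly_induct2) (simp_all add: algebra_simps)

lemma act_smult: "act (smult c p) F i = c * act p F i"
  by (induction p arbitrary: i) (simp_all add: algebra_simps)

lemma act_diff: "act (p - q) F i = act p F i - act q F i"
  using act_add[of "p - q" q F i] by simp

lemma act_sum: "act (\<Sum>k\<in>A. p k) F i = (\<Sum>k\<in>A. act (p k) F i)"
  by (induction A rule: infinite_finite_induct) (simp_all add: act_add)

lemma act_monom: "act (monom c k) F i = c * F (i + int k)"
  by (induction k arbitrary: i) (simp_all add: monom_0 monom_Suc algebra_simps)

lemma act_mult: "act (p * q) F i = act p (act q F) i"
  by (induction p arbitrary: i) (simp_all add: act_add act_smult mult_pCons_left)

lemma act_commute: "act p (act q F) i = act q (act p F) i"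
  by (metis act_mult mult.commute)

lemma act_shift: "act p (\<lambda>j. F (i + j)) m = act p F (i + m)"
  by (induction p arbitrary: m) (simp_all add: algebra_simps)

lemma act_fun_diff: "act p (\<lambda>j. F j - G j) i = act p F i - act p G i"
  by (induction p arbitrary: i) (simp_all add: algebra_simps)

lemma act_fun_add: "act p (\<lambda>j. F j + G j) i = act p F i + act p G i"
  by (induction p arbitrary: i) (simp_all add: algebra_simps)

lemma act_fun_scale: "act p (\<lambda>j. c * F j) i = c * act p F i"
  by (induction p arbitrary: i) (simp_all add: algebra_simps)

text \<open>
  Under \<open>act\<close>, sequences are functionals on polynomials and \<open>theta\<close> is the transpose of the
  derivative, so \<open>act_theta\<close> is the Heisenberg relation.
\<close>

definition theta :: "(int \<Rightarrow> 'a::comm_ring_1) \<Rightarrow> int \<Rightarrow> 'a" where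
  "theta F i = of_int i * F (i - 1)"

lemma act_theta: "act p (theta F) i = of_int i * act p F (i - 1) + act (pderiv p) F i"
  by (induction p arbitrary: i) (simp_all add: theta_def pderiv_pCons act_add algebra_simps)

text \<open>Vanishing of the functional on the ideal generated by \<open>g\<close>. Only exponents
  of the algebra are tested: for the one-sided algebra, values of \<open>F\<close> at negative
  integers are junk.\<close>

definition annihilates :: "witt_kind \<Rightarrow> 'a::comm_ring_1 poly \<Rightarrow> (int \<Rightarrow> 'a) \<Rightarrow> bool" where
  "annihilates K g F \<longleftrightarrow> (\<forall>i\<in>exponents K. act g F i = 0)"

lemma exponents_add: "i \<in> exponents K \<Longrightarrow> j \<in> exponents K \<Longrightarrow> i + j \<in> exponents K"
  and exponents_of_nat [simp]: "int m \<in> exponents K"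
  and exponents_0_1 [simp]: "0 \<in> exponents K" "1 \<in> exponents K"
  by (auto simp: exponents_def split: if_splits)

lemma act_eq_0:
  assumes "\<And>j. j \<in> exponents K \<Longrightarrow> F j = 0" "i \<in> exponents K"
  shows "act p F i = 0"
  unfolding act_def by (rule sum.neutral) (simp add: assms exponents_add)

lemma annihilates_mult:
  assumes "annihilates K g F"
  shows "annihilates K (p * g) F" "annihilates K (g * p) F"
proof -
  show "annihilates K (p * g) F"
    using assms unfolding annihilates_def act_mult by (auto intro: act_eq_0)
  then show "annihilates K (g * p) F" by (simp add: mult.commute)
qed

text \<open>\<open>g\<close> is the characteristic polynomial of the recurrence, up to a power of x
  that absorbs the starting index of the one-sided case.\<close>

lemma recurrent_iff:
  fixes F :: "int \<Rightarrow> 'a::field_char_0"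
  shows "recurrent K F \<longleftrightarrow> (\<exists>g. g \<noteq> 0 \<and> annihilates K g F)"
proof
  assume "recurrent K F"
  then obtain r h where r: "\<And>m. K = One_Sided_Witt \<longrightarrow> m > int r \<Longrightarrow> F m = (\<Sum>k =
      1..r. h k * F (m - int k))"
    unfolding recurrent_def by blast
  define g where "g = monom 1 r - (\<Sum>k = 1..r. monom (h k) (r - k))"
  have "coeff g r = 1"
    by (auto simp: g_def coeff_sum intro!: sum.neutral)
  \<comment> \<open>The one-sided recurrence starts at m = r + 1, where \<open>g\<close> is applied
    at position 1; the factor x moves this to position 0.\<close>
  then have "pCons 0 g \<noteq> 0" by auto
  moreover have "act (pCons 0 g) F i = 0" if "i \<in> exponents K" for i
  proof -
    have "(\<Sum>k = 1..r. h k * F (i + 1 + int (r - k))) = (\<Sum>k = 1..r. h k * F (i + 1 + int r - int k))"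
      by (intro sum.cong) (auto simp: of_nat_diff algebra_simps)
    then show ?thesis
      using that r[of "i + 1 + int r"]
      by (auto simp: g_def act_diff act_sum act_monom exponents_def split: if_splits)
  qed
  ultimately show "\<exists>g. g \<noteq> 0 \<and> annihilates K g F"
    unfolding annihilates_def by blast
next
  assume "\<exists>g. g \<noteq> 0 \<and> annihilates K g F"
  then obtain g where g: "g \<noteq> 0" "\<And>i. i \<in> exponents K \<Longrightarrow> act g F i = 0"
    by (auto simp: annihilates_def)
  define s where "s = degree g"
  define h where "h k = (if k \<le> s then - coeff g (s - k) / lead_coeff g else 0)" for k
  \<comment> \<open>Order \<open>Suc s\<close> instead of \<open>s\<close> keeps the order positive
    when \<open>g\<close> is constant; the last coefficient is 0.\<close>
  have "F m = (\<Sum>k = 1..Suc s. h k * F (m - int k))" if "K = One_Sided_Witt \<longrightarrow> m > int (Suc s)" for m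
  proof -
    have "0 = act g F (m - int s)"
      using g(2)[of "m - int s"] that by (auto simp: exponents_def)
    also have "\<dots> = (\<Sum>k\<le>s. coeff g (s - k) * F (m - int s + int (s - k)))"
      unfolding act_def s_def [symmetric]
      by (rule sum.reindex_bij_witness[of _ "\<lambda>k. s - k" "\<lambda>k. s - k"]) auto
    also have "\<dots> = (\<Sum>k\<in>insert 0 {1..s}. coeff g (s - k) * F (m - int k))"
      by (rule sum.cong) (auto simp: of_nat_diff)
    also have "\<dots> = lead_coeff g * F m + (\<Sum>k = 1..s. coeff g (s - k) * F (m - int k))"
      by (simp add: s_def)
    finally have "F m = - (\<Sum>k = 1..s. coeff g (s - k) * F (m - int k)) / lead_coeff g"
      using g(1) by (simp add: field_simps eq_neg_iff_add_eq_0)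
    also have "\<dots> = (\<Sum>k = 1..s. h k * F (m - int k))"
      unfolding sum_negf [symmetric] sum_divide_distrib
      by (rule sum.cong) (auto simp: h_def)
    finally show ?thesis by (simp add: h_def)
  qed
  then show "recurrent K F"
    unfolding recurrent_def by (intro exI[of _ "Suc s"] conjI exI[of _ h]) auto
qed

text \<open>Finite dimension of the solution space, in the form that \<open>tensorI\<close> asks
  for. The first \<open>degree g\<close> values determine all later ones. Going backwards requires a
  nonzero constant coefficient, so in the two-sided case the induction first removes factors
  x.\<close>

lemma annihilated_determined:
  fixes g :: "'a::field_char_0 poly"
  assumes "g \<noteq> 0"
  shows "\<exists>P. finite P \<and> P \<subseteq> exponents K \<and>
    (\<forall>H. annihilates K g H \<longrightarrow> (\<forall>p\<in>P. H p = 0) \<longrightarrow> (\<forall>i\<in>exponents K. H i = 0))"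
  using assms
proof (induction g)
  case 0
  then show ?case by simp
next
  case (pCons a p)
  show ?case
  proof (cases "a = 0 \<and> K \<noteq> One_Sided_Witt")
    case True
    have "annihilates K p H" if "annihilates K (pCons a p) H" for H
      unfolding annihilates_def
    proof
      fix i
      assume "i \<in> exponents K"
      \<comment> \<open>The shift is invertible in the two-sided case, as \<open>i - 1\<close> is
        again an exponent.\<close>
      have "act (pCons a p) H (i - 1) = 0"
        using that True by (simp add: annihilates_def exponents_def del: act_pCons)
      then show "act p H i = 0" using True by simp
    qed
    note descend = this
    have "p \<noteq> 0" using pCons.prems True by auto
    from pCons.IH[OF this] obtain P where P: "finite P" "P \<subseteq> exponents K"
      and det: "\<And>H. annihilates K p H \<Longrightarrow> \<forall>p\<in>P. H p = 0 \<Longrightarrow> \<forall>i\<in>exponents K. H i = 0"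
      by (elim exE conjE) simp
    show ?thesis
      by (intro exI[of _ P] conjI allI impI P det descend) assumption+
  next
    case False
    define g where "g = pCons a p"
    have g0: "lead_coeff g \<noteq> 0" unfolding leading_coeff_0_iff g_def by (rule pCons.prems)
    show ?thesis unfolding g_def [symmetric]
    proof (intro exI[of _ "int ` {..<degree g}"] conjI allI impI)
      fix H assume H: "annihilates K g H" and P: "\<forall>p\<in>int ` {..<degree g}. H p = 0"
      have forward: "H (int m) = 0" for m
      proof (induction m rule: less_induct)
        case (less m)
        show ?case
        proof (cases "m < degree g")
          case True
          then show ?thesis using P by auto
        next
          case False
          have "0 = act g H (int (m - degree g))"
            using H by (simp add: annihilates_def)
          also have "\<dots> = (\<Sum>k<degree g. coeff g k * H (int (m - degree g) + int k)) +
              lead_coeff g * H (int m)"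
            using False unfolding act_def lessThan_Suc_atMost [symmetric] by (simp flip: of_nat_add)
          also have "(\<Sum>k<degree g. coeff g k * H (int (m - degree g) + int k)) = 0"
            using False by (intro sum.neutral ballI)
              (simp add: less del: of_nat_diff flip: of_nat_add)
          finally show ?thesis using g0 by simp
        qed
      qed
      show "\<forall>i\<in>exponents K. H i = 0"
      proof (cases "K = One_Sided_Witt")
        case True
        then show ?thesis using forward by (auto simp: exponents_def elim: nonneg_int_cases)
      next
        case two_sided: False
        have "\<forall>i\<ge>- int m. H i = 0" for m
        proof (induction m)
          case 0
          then show ?case using forward by (auto elim: nonneg_int_cases)
        next
          case (Suc m)
          have "act p H (- int m) = 0"
            unfolding act_def using Suc by (intro sum.neutral ballI) simp
          moreover have "act g H (- int (Suc m)) = 0"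
            using H two_sided by (simp add: annihilates_def exponents_def)
          \<comment> \<open>Here the constant coefficient \<open>a\<close> is nonzero, so the
            recurrence can be solved for its lowest term.\<close>
          ultimately have "H (- int (Suc m)) = 0"
            using two_sided False by (simp add: g_def)
          moreover have "i = - int (Suc m) \<or> i \<ge> - int m" if "i \<ge> - int (Suc m)" for i
            using that by linarith
          ultimately show ?case using Suc by metis
        qed
        moreover have "i \<ge> - int (nat (- i))" for i by simp
        ultimately show ?thesis by metis
      qed
    qed auto
  qed
qed

section \<open>The finite dual\<close>

lemma unit_vector_Pow [simp]: "unit_vector b (Pow i) = (if Pow i = b then 1 else 0)"
  by (simp add: unit_vector_def)

lemma finite_exponents_support:
  assumes "u \<in> witt_space K"
  shows "finite {i. u (Pow i) \<noteq> 0}"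
proof -
  have "finite (Pow -` {b. u b \<noteq> 0})"
    using finite_support_witt_space[OF assms] by (intro finite_vimageI) (auto simp: inj_def)
  then show ?thesis by (simp add: vimage_def)
qed

lemma eps_sum_superset:
  assumes "u \<in> witt_space K" "finite S" "{i. u (Pow i) \<noteq> 0} \<subseteq> S"
  shows "eps_sum K F u = (\<Sum>i\<in>S. F i * u (Pow i))"
proof -
  have "eps_sum K F u = (\<Sum>i | u (Pow i) \<noteq> 0. F i * u (Pow i))"
    using assms by (simp add: eps_sum_def)
  also have "\<dots> = (\<Sum>i\<in>S. F i * u (Pow i))"
    by (rule sum.mono_neutral_left) (use assms in auto)
  finally show ?thesis .
qed

lemma eps_sum_outside: "u \<notin> witt_space K \<Longrightarrow> eps_sum K F u = 0"
  by (simp add: eps_sum_def)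

lemma eps_sum_dual: "eps_sum K F \<in> dual_space (witt_space K)"
proof -
  have "eps_sum K F (u + v) = eps_sum K F u + eps_sum K F v"
    if u: "u \<in> witt_space K" and v: "v \<in> witt_space K" for u v :: "witt_index \<Rightarrow> 'a"
  proof -
    define S where "S = {i. u (Pow i) \<noteq> 0} \<union> {i. v (Pow i) \<noteq> 0}"
    have S: "finite S" using u v by (simp add: S_def finite_exponents_support)
    have "u + v \<in> witt_space K" using u v by (intro fun_space.subspace_add subspace_witt_space)
    then show ?thesis
      using u v S by (subst (1 2 3) eps_sum_superset[of _ K S])
        (auto simp: S_def distrib_left sum.distrib)
  qed
  moreover have "eps_sum K F (fscale c u) = c * eps_sum K F u"
    if u: "u \<in> witt_space K" for u :: "witt_index \<Rightarrow> 'a" and c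
  proof -
    define S where "S = {i. u (Pow i) \<noteq> 0}"
    have S: "finite S" using u by (simp add: S_def finite_exponents_support)
    have "fscale c u \<in> witt_space K" using u by (intro fun_space.subspace_scale subspace_witt_space)
    then show ?thesis
      using u S by (subst (1 2) eps_sum_superset[of _ K S])
        (auto simp: S_def sum_distrib_left mult_ac)
  qed
  ultimately show ?thesis
    by (auto simp: dual_space_def eps_sum_outside)
qed

lemma eps_sum_unit_vector:
  "b \<in> witt_basis K \<Longrightarrow> eps_sum K F (unit_vector b) = (case b of Pow i \<Rightarrow> F i | Central \<Rightarrow> 0)"
  by (subst eps_sum_superset[of _ _ "case b of Pow i \<Rightarrow> {i} | Central \<Rightarrow> {}"])
    (auto split: witt_index.splits)

lemma Pow_in_witt_basis [simp]: "Pow i \<in> witt_basis K \<longleftrightarrow> i \<in> exponents K"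
  by (auto simp: witt_basis_def)

lemma eps_sum_xpow [simp]: "i \<in> exponents K \<Longrightarrow> eps_sum K F (xpow i) = F i"
  by (simp add: eps_sum_unit_vector)

lemma dual_space_zero:
  assumes "f \<in> dual_space V" "0 \<in> V"
  shows "f 0 = 0"
proof -
  have "f 0 = f 0 + f 0" using dual_space_add[OF assms assms(2)] by (simp only: add_0_right)
  then show ?thesis by (simp only: add_cancel_right_right)
qed

lemma dual_witt_space_eqI:
  assumes f: "f \<in> dual_space (witt_space K)" and g: "g \<in> dual_space (witt_space K)"
    and eq: "\<And>b. b \<in> witt_basis K \<Longrightarrow> f (unit_vector b) = g (unit_vector b)"
  shows "f = g"
proof
  fix u
  show "f u = g u"
  proof (cases "u \<in> witt_space K")
    case True
    then show ?thesis
    proof (induction rule: witt_space_induct)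
      case zero
      have 0: "0 \<in> witt_space K" by (rule fun_space.subspace_0[OF subspace_witt_space])
      show ?case
        by (simp only: dual_space_zero[OF f 0] dual_space_zero[OF g 0])
    next
      case (step c b u)
      have b: "unit_vector b \<in> witt_space K" using step by simp
      then have "fscale c (unit_vector b) \<in> witt_space K"
        by (intro fun_space.subspace_scale subspace_witt_space)
      then show ?case
        by (simp only: dual_space_add[OF f _ step(2)] dual_space_add[OF g _ step(2)]
            dual_space_scale[OF f b] dual_space_scale[OF g b] eq[OF step(1)] step(3))
    qed
  qed (simp add: dual_space_outside[OF f] dual_space_outside[OF g])
qed

lemma subspace_dual_space: "fun_space.subspace (dual_space V)"
  by (rule fun_space.subspaceI) (auto simp: dual_space_def algebra_simps)

lemma eps_sum_add: "eps_sum K F + eps_sum K G = eps_sum K (\<lambda>i. F i + G i)"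
  by (rule ext) (simp add: eps_sum_def sum.distrib distrib_right)

lemma eps_sum_scale: "fscale c (eps_sum K F) = eps_sum K (\<lambda>i. c * F i)"
  by (rule ext) (simp add: eps_sum_def sum_distrib_left mult.assoc)

lemma eps_sum_cong: "(\<And>i. i \<in> exponents K \<Longrightarrow> F i = G i) \<Longrightarrow> eps_sum K F = eps_sum K G"
  by (rule dual_witt_space_eqI[OF eps_sum_dual eps_sum_dual])
    (auto simp: eps_sum_unit_vector split: witt_index.splits)

section \<open>Functionals killed by an ideal, and goodness of the recurrent ones\<close>

definition annihilated :: "witt_kind \<Rightarrow> 'a::field_char_0 poly \<Rightarrow> ((witt_index \<Rightarrow> 'a) \<Rightarrow> 'a) set" where
  "annihilated K g = {eps_sum K F | F. annihilates K g F}"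

lemma subspace_annihilated: "fun_space.subspace (annihilated K g)"
proof (rule fun_space.subspaceI)
  have "0 = eps_sum K (\<lambda>_. 0)" "annihilates K g (\<lambda>_. 0)"
    by (auto simp: fun_eq_iff eps_sum_def annihilates_def act_def)
  then show "0 \<in> annihilated K g" unfolding annihilated_def by blast
qed (force simp: annihilated_def eps_sum_add eps_sum_scale annihilates_def act_fun_add
    act_fun_scale)+

lemma annihilated_mult: "annihilated K g \<subseteq> annihilated K (p * g)"
    "annihilated K g \<subseteq> annihilated K (g * p)"
  unfolding annihilated_def using annihilates_mult by blast+

lemma recurrent_functionals: "{eps_sum K F | F. recurrent K F} = (\<Union>g\<in>- {0}. annihilated K g)"
  by (auto simp: annihilated_def recurrent_iff)

lemma subspace_recurrent:
  "fun_space.subspace {eps_sum K F | F :: int \<Rightarrow> 'a::field_char_0. recurrent K F}"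
  unfolding recurrent_functionals
proof (rule fun_space.subspaceI)
  show "0 \<in> (\<Union>g\<in>- {0 :: 'a poly}. annihilated K g)"
    using fun_space.subspace_0[OF subspace_annihilated[of K 1]] by auto
next
  fix f h :: "(witt_index \<Rightarrow> 'a) \<Rightarrow> 'a"
  assume "f \<in> (\<Union>g\<in>- {0}. annihilated K g)" "h \<in> (\<Union>g\<in>- {0}. annihilated K g)"
  then obtain p q where pq: "p \<noteq> 0" "q \<noteq> 0" "f \<in> annihilated K p" "h \<in> annihilated K q" by auto
  \<comment> \<open>The product annihilates both summands and is nonzero.\<close>
  then have "f + h \<in> annihilated K (p * q)"
    using annihilated_mult by (intro fun_space.subspace_add subspace_annihilated) blast+
  with pq show "f + h \<in> (\<Union>g\<in>- {0}. annihilated K g)" by auto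
next
  fix c and f :: "(witt_index \<Rightarrow> 'a) \<Rightarrow> 'a"
  assume "f \<in> (\<Union>g\<in>- {0}. annihilated K g)"
  then show "fscale c f \<in> (\<Union>g\<in>- {0}. annihilated K g)"
    using fun_space.subspace_scale[OF subspace_annihilated] by blast
qed

interpretation witt: lie_algebra_on "witt_space K" "witt_bracket K"
  by (rule lie_algebra_on.intro) (rule lie_algebra_witt)

lemma dual_cobracket_row_dual:
  assumes f: "f \<in> dual_space (witt_space K)"
  shows "(\<lambda>v. dual_cobracket (witt_space K) (witt_bracket K) f (u, v)) \<in> dual_space (witt_space K)"
  by (auto simp: dual_space_def dual_cobracket_def witt.bracket_linear dual_space_add[OF f]
    dual_space_scale[OF f])

lemma functional_basis_bracket:
  assumes f: "f \<in> dual_space (witt_space K)" and "i \<in> exponents K" "j \<in> exponents K"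
  shows "f (basis_bracket K (Pow i) (Pow j)) = of_int (j - i) * f (xpow (i + j - 1)) +
    (if K = Virasoro \<and> i + j = 2 then of_int ((i - 1) ^ 3 - (i - 1)) / 12 * f
        (unit_vector Central) else 0)"
proof -
  define C :: "witt_index \<Rightarrow> 'a" where "C = (if K = Virasoro \<and> i - 1 + (j - 1) = 0
      then fscale (of_int ((i - 1) ^ 3 - (i - 1)) / 12) (unit_vector Central) else 0)"
  have 0: "0 \<in> witt_space K" by (rule fun_space.subspace_0[OF subspace_witt_space])
  have C: "C \<in> witt_space K"
    unfolding C_def using 0 by (auto intro!: fun_space.subspace_scale subspace_witt_space simp:
      witt_basis_def)
  have X: "f (fscale (of_int (j - i)) (xpow (i + j - 1))) = of_int (j - i) * f (xpow (i + j - 1)) \<and>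
    fscale (of_int (j - i)) (xpow (i + j - 1)) \<in> witt_space K"
  \<comment> \<open>For \<open>i = j = 0\<close> the power x^(-1) may lie outside the algebra, where
    \<open>f\<close> is not linear; the vanishing coefficient is therefore treated
    separately.\<close>
  proof (cases "i = j")
    case True
    have "fscale (of_int (j - i)) (xpow (i + j - 1)) = (0 :: witt_index \<Rightarrow> 'a)"
      by (simp only: True diff_self of_int_0 fscale_zero)
    then show ?thesis using 0 dual_space_zero[OF f 0] True by (simp only:) simp
  next
    case False
    then have "i + j - 1 \<in> exponents K" using assms(2,3)
        by (auto simp: exponents_def split: if_splits)
    then show ?thesis
      using f by (simp add: dual_space_scale[OF f] fun_space.subspace_scale[OF subspace_witt_space])
  qed
  have fC: "f C = (if K = Virasoro \<and> i + j = 2 then of_int ((i - 1) ^ 3 - (i - 1)) / 12 * f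
      (unit_vector Central) else 0)"
  proof (cases "K = Virasoro \<and> i + j = 2")
    case True
    then have C': "C = fscale (of_int ((i - 1) ^ 3 - (i - 1)) / 12) (unit_vector Central)"
      and V: "unit_vector Central \<in> witt_space K"
      unfolding C_def by (auto simp: witt_basis_def)
    show ?thesis unfolding C' dual_space_scale[OF f V] using True by simp
  next
    case False
    then have "C = 0" unfolding C_def by auto
    then show ?thesis using False dual_space_zero[OF f 0] by (simp only:) simp
  qed
  show ?thesis
    unfolding basis_bracket.simps C_def [symmetric] dual_space_add[OF f conjunct2[OF X] C]
      conjunct1[OF X] fC ..
qed

text \<open>
  The extra factor \<open>x\<close> in the annihilator keeps the junk coefficient at \<open>x\<^sup>-\<^sup>1\<close> out of the
  recurrence in the one-sided case.
\<close>

lemma dual_cobracket_row: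
  assumes F: "annihilates K g F"
  shows "(\<lambda>v. dual_cobracket (witt_space K) (witt_bracket K) (eps_sum K F) (u, v)) \<in>
    annihilated K (pCons 0 (g * g))"
    (is "?row u \<in> ?A")
proof (cases "u \<in> witt_space K")
  case True
  have f0: "eps_sum K F 0 = 0"
    by (rule dual_space_zero[OF eps_sum_dual fun_space.subspace_0[OF subspace_witt_space]])
  from True show ?thesis
  proof (induction rule: witt_space_induct)
    case zero
    have "?row 0 = 0"
      by (rule ext, simp only: dual_cobracket_def prod.case, simp only: witt_bracket_zero f0
        if_cancel)
        (simp only: zero_fun_apply)
    then show ?case using fun_space.subspace_0[OF subspace_annihilated] by (simp only:)
  next
    case (step c b u)
    have "?row (unit_vector b) \<in> ?A"
    proof (cases b)
      case Central
      have "?row (unit_vector b) = 0"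
      proof (rule dual_witt_space_eqI[OF dual_cobracket_row_dual fun_space.subspace_0[OF
          subspace_dual_space]])
        fix b' assume "b' \<in> witt_basis K"
        show "?row (unit_vector b) (unit_vector b') = 0 (unit_vector b')"
          by (simp only: dual_cobracket_def prod.case Central witt_bracket_unit_vector
            basis_bracket.simps
              f0 zero_fun_apply if_cancel)
      qed (rule eps_sum_dual)
      then show ?thesis using fun_space.subspace_0[OF subspace_annihilated] by (simp only:)
    next
      case (Pow i)
      have i: "i \<in> exponents K" using step Pow by simp
      \<comment> \<open>\<open>Fi\<close> represents v -> f (x^i v), so \<open>H\<close> takes x^j
        to f (x^i (x^j)' - (x^i)' x^j): the row of the form at x^i.\<close>
      define Fi where "Fi j = F (i + j)" for j
      define H where "H j = theta Fi j - of_int i * Fi (j - 1)" for j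
      have "?row (unit_vector b) = eps_sum K H"
      proof (rule dual_witt_space_eqI[OF dual_cobracket_row_dual eps_sum_dual])
        fix b' assume b': "b' \<in> witt_basis K"
        show "?row (unit_vector b) (unit_vector b') = eps_sum K H (unit_vector b')"
        proof (cases b')
          case Central
          have "basis_bracket K b Central = (0 :: witt_index \<Rightarrow> 'a)" by (cases b) simp_all
          then show ?thesis using b' unfolding Central
            by (simp only: dual_cobracket_def prod.case witt_bracket_unit_vector f0
              eps_sum_unit_vector
                if_cancel witt_index.case)
        next
          case (Pow j)
          then have j: "j \<in> exponents K" using b' by simp
          \<comment> \<open>This makes the cocycle term of the bracket disappear.\<close>
          have "eps_sum K F (unit_vector Central) = 0"
            by (cases "Central \<in> witt_basis K") (simp_all add: eps_sum_unit_vector eps_sum_outside)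
          moreover have "?row (unit_vector b) (unit_vector b') =
              eps_sum K F (basis_bracket K (Pow i) (Pow j))"
            using i j \<open>b = Pow i\<close> Pow by (simp add: dual_cobracket_def del: basis_bracket.simps)
          ultimately have "?row (unit_vector b) (unit_vector b') =
              of_int (j - i) * eps_sum K F (xpow (i + j - 1))"
            by (simp only: functional_basis_bracket[OF eps_sum_dual i j, of F] mult_zero_right
              if_cancel add_0_right)
          also have "\<dots> = of_int (j - i) * F (i + j - 1)"
          proof (cases "i = j")
            case False
            then have "i + j - 1 \<in> exponents K" using i j
                by (auto simp: exponents_def split: if_splits)
            then show ?thesis by simp
          qed simp
          finally show ?thesis using j Pow
            by (simp add: H_def theta_def Fi_def algebra_simps)
        qed
      qed (rule eps_sum_dual)
      moreover have "annihilates K (pCons 0 (g * g)) H"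
        unfolding annihilates_def
      proof
        fix m assume m: "m \<in> exponents K"
        have g: "act g Fi n = 0" if "n \<in> exponents K" for n
          using F that i unfolding Fi_def act_shift annihilates_def by (auto intro: exponents_add)
        have m1: "m + 1 \<in> exponents K" using m by (simp add: exponents_add)
        have gg: "act (p * g) Fi n = 0" if "n \<in> exponents K" for n p
          unfolding act_mult by (rule act_eq_0[OF g that])
        \<comment> \<open>By \<open>act_theta\<close> every term is a multiple of \<open>g\<close>
          applied to \<open>Fi\<close>, the derivative of \<open>g * g\<close> included. Evaluation
          at \<open>m + 1\<close> keeps the shifted index \<open>m\<close> an exponent.\<close>
        have "act (g * g) H (m + 1) = act (g * g) (theta Fi) (m + 1) - of_int i * act (g * g) Fi m"
          unfolding H_def act_fun_diff act_fun_scale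
          using act_shift[of "g * g" "Fi" "-1" "m + 1"] by simp
        also have "\<dots> = 0"
          using gg[OF m, of g] gg[OF m1, of "pderiv g"] unfolding act_theta pderiv_mult act_add
          by (simp add: mult.commute)
        finally show "act (pCons 0 (g * g)) H m = 0" by simp
      qed
      ultimately show ?thesis by (auto simp: annihilated_def)
    qed
    moreover have "?row (fscale c (unit_vector b) + u) = fscale c (?row (unit_vector b)) + ?row u"
    proof
      fix v
      have b: "(unit_vector b :: witt_index \<Rightarrow> 'a) \<in> witt_space K" using step by simp
      then have "fscale c (unit_vector b) + u \<in> witt_space K" using step by simp
      moreover have "eps_sum K F (witt_bracket K (fscale c (unit_vector b) + u) v) =
        c * eps_sum K F (witt_bracket K (unit_vector b) v) + eps_sum K F
            (witt_bracket K u v)" if v: "v \<in> witt_space K"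
      proof -
        have "fscale c (unit_vector b) \<in> witt_space K" using b by (rule witt.scale_closed)
        from witt.bracket_add_left[OF v this step(2)]
        have "witt_bracket K (fscale c (unit_vector b) + u) v =
            fscale c (witt_bracket K (unit_vector b) v) + witt_bracket K u v"
          unfolding witt.bracket_scale_left[OF v b] .
        then show ?thesis
          using dual_space_add[OF eps_sum_dual witt.scale_closed[OF witt.bracket_closed[OF b v]]
            witt.bracket_closed[OF step(2) v]]
            dual_space_scale[OF eps_sum_dual witt.bracket_closed[OF b v]]
          by (simp only:)
      qed
      ultimately show "?row (fscale c (unit_vector b) + u) v = (fscale c (?row (unit_vector b)) +
          ?row u) v"
        using b step(2) unfolding plus_fun_apply [of
          "fscale c (?row (unit_vector b))"] fscale_apply [of c "?row (unit_vector b)"]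
        by (cases "v \<in> witt_space K")
          (simp_all only: dual_cobracket_def prod.case simp_thms if_True if_False mult_zero_right
              add_0_right)
    qed
    ultimately show ?case
      using step by (simp only: fun_space.subspace_add[OF subspace_annihilated]
        fun_space.subspace_scale[OF subspace_annihilated])
  qed
next
  case False
  then have "?row u = 0" by (auto simp: fun_eq_iff dual_cobracket_def)
  then show ?thesis using fun_space.subspace_0[OF subspace_annihilated] by (simp only:)
qed

lemma good_recurrent:
  "good_subspace (witt_space K) (witt_bracket K) {eps_sum K F | F. recurrent K (F :: int \<Rightarrow>
      'a::field_char_0)}"
  unfolding good_subspace_def
proof (intro conjI ballI subspace_recurrent)
  show "{eps_sum K F | F. recurrent K F} \<subseteq> dual_space (witt_space K)"
    using eps_sum_dual by blast
next
  fix f :: "(witt_index \<Rightarrow> 'a) \<Rightarrow> 'a" assume "f \<in> {eps_sum K F | F. recurrent K F}"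
  then obtain F g where f: "f = eps_sum K F" and g: "g \<noteq> 0" "annihilates K g F"
    by (auto simp: recurrent_iff)
  define q where "q = pCons 0 (g * g)"
  define \<tau> where "\<tau> = dual_cobracket (witt_space K) (witt_bracket K) f"
  have q: "q \<noteq> 0" using g(1) by (simp add: q_def)
  have row: "(\<lambda>v. \<tau> (u, v)) \<in> annihilated K q" for u
    unfolding \<tau>_def f q_def by (rule dual_cobracket_row[OF g(2)])
  have anti: "\<tau> (u, v) = - \<tau> (v, u)" for u v
  proof (cases "u \<in> witt_space K \<and> v \<in> witt_space K")
    case True
    then have "f (witt_bracket K u v) = - f (witt_bracket K v u)"
      using witt.bracket_anti[of v K u] dual_space_minus[OF eps_sum_dual, of
        "witt_bracket K v u" K F]
      unfolding f by (simp only: witt.bracket_closed)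
    then show ?thesis using True by (simp add: \<tau>_def dual_cobracket_def)
  qed (auto simp: \<tau>_def dual_cobracket_def)
  have col: "(\<lambda>u. \<tau> (u, v)) \<in> annihilated K q" for v
  proof -
    have "(\<lambda>u. \<tau> (u, v)) = - (\<lambda>u. \<tau> (v, u))"
      unfolding fun_Compl_def by (rule ext) (rule anti)
    then show ?thesis
      using fun_space.subspace_neg[OF subspace_annihilated row] by (simp only:)
  qed
  obtain P where P: "finite P" "P \<subseteq> exponents K"
    "\<And>H. annihilates K q H \<Longrightarrow> \<forall>p\<in>P. H p = 0 \<Longrightarrow> \<forall>i\<in>exponents K. H i = 0"
    using annihilated_determined[OF q, of K] by (elim exE conjE) simp
  \<comment> \<open>All rows and columns lie in one space whose members are determined by their
    values at finitely many powers of x.\<close>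
  have "\<tau> \<in> tensor (annihilated K q) (annihilated K q)"
  proof (rule tensorI[of "xpow ` P"])
    fix w assume w: "w \<in> annihilated K q" and 0: "\<And>t. t \<in> xpow ` P \<Longrightarrow> w t = 0"
    from w obtain H where H: "w = eps_sum K H" "annihilates K q H" by (auto simp: annihilated_def)
    have "H p = 0" if "p \<in> P" for p
      using 0[of "xpow p"] that P(2) by (auto simp: H(1) subset_iff)
    then have "\<forall>i\<in>exponents K. H i = 0" using P(3)[OF H(2)] by blast
    then have "w = eps_sum K (\<lambda>_. 0)" unfolding H(1) by (intro eps_sum_cong) simp
    then show "w = 0" by (simp add: eps_sum_def fun_eq_iff)
  qed (use P(1) row col subspace_annihilated in auto)
  moreover have "annihilated K q \<subseteq> {eps_sum K F | F. recurrent K F}"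
    unfolding recurrent_functionals using q by blast
  ultimately show "\<tau> \<in> tensor {eps_sum K F | F. recurrent K F} {eps_sum K F | F. recurrent K F}"
    using tensor_mono by blast
qed

subsection \<open>Maximality\<close>

text \<open>Equality of the leading coefficients of d c' and c d' would give deg c = deg d, because
  in characteristic zero degrees can be compared as scalars.\<close>

lemma wronskian_nonzero:
  fixes c d :: "'a::field_char_0 poly"
  assumes "c \<noteq> 0" "degree c < degree d"
  shows "d * pderiv c - c * pderiv d \<noteq> 0"
proof
  assume "d * pderiv c - c * pderiv d = 0"
  then have eq: "d * pderiv c = c * pderiv d" by simp
  have lead: "lead_coeff (pderiv p) = of_nat (degree p) * lead_coeff p" for p :: "'a poly"
    by (cases "degree p") (simp_all add: degree_pderiv coeff_pderiv coeff_eq_0)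
  have "lead_coeff d * (of_nat (degree c) * lead_coeff c) = lead_coeff c * (of_nat (degree d) *
      lead_coeff d)"
    using arg_cong[OF eq, of lead_coeff] by (simp only: lead_coeff_mult lead)
  moreover have "d \<noteq> 0" using assms(2) by auto
  ultimately show False using assms by simp
qed

lemma act_cong:
  assumes "\<And>j. j \<in> exponents K \<Longrightarrow> F j = G j" "i \<in> exponents K"
  shows "act p F i = act p G i"
  unfolding act_def by (rule sum.cong) (simp_all add: assms exponents_add)

text \<open>The hypotheses put \<open>c\<close> and \<open>d\<close> into the radical: f (x^i c') =
  f ((x^i)' c). Applying \<open>act_theta\<close> to both products yields the same term m f (x^(m-1)
  c d), so subtraction leaves the value at the Wronskian equal to its own negative.\<close>

lemma annihilates_wronskian:
  fixes F :: "int \<Rightarrow> 'a::field_char_0"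
  assumes c: "\<And>i. i \<in> exponents K \<Longrightarrow> act (pderiv c) F i = theta (act c F) i"
    and d: "\<And>i. i \<in> exponents K \<Longrightarrow> act (pderiv d) F i = theta (act d F) i"
  shows "annihilates K (d * pderiv c - c * pderiv d) F"
  unfolding annihilates_def
proof
  fix m assume m: "m \<in> exponents K"
  have "act (d * pderiv c) F m = of_int m * act d (act c F) (m - 1) + act (pderiv d * c) F m"
    unfolding act_mult using act_cong[OF c m, where p = d] by (simp add: act_theta)
  moreover have "act (c * pderiv d) F m = of_int m * act c (act d F) (m - 1) + act (pderiv c * d)
      F m"
    unfolding act_mult using act_cong[OF d m, where p = c] by (simp add: act_theta)
  ultimately have "2 * (act (d * pderiv c) F m - act (c * pderiv d) F m) = 0"
    by (simp add: act_commute[of c d] mult.commute)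
  then show "act (d * pderiv c - c * pderiv d) F m = 0"
    by (simp add: act_diff)
qed

lemma finite_rank_recurrent:
  fixes F :: "int \<Rightarrow> 'a::field_char_0" and p q :: "nat \<Rightarrow> int \<Rightarrow> 'a"
  assumes rank: "\<And>i j. i \<in> exponents K \<Longrightarrow> j \<in> exponents K \<Longrightarrow>
      of_int (j - i) * F (i + j - 1) = (\<Sum>k<R. p k i * q k j)"
  shows "recurrent K F"
proof -
  define radical where "radical c \<longleftrightarrow> (\<forall>i\<in>exponents K. act (pderiv c) F i = theta (act c F) i)" for c
  have ex: "\<exists>c. radical c \<and> (\<exists>j\<in>J. coeff c j \<noteq> 0) \<and> (\<forall>j. j \<notin> J \<longrightarrow> coeff c j = 0)"
    if J: "finite J" "card J > R" for J :: "nat set"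
  proof -
    obtain v where v: "\<exists>j\<in>J. v j \<noteq> 0" "\<And>k. k < R \<Longrightarrow> (\<Sum>j\<in>J. v j * q k (int j)) = 0"
      using underdetermined_system[OF J, of "\<lambda>k j. q k (int j)"] by blast
    define c where "c = (\<Sum>j\<in>J. monom (v j) j)"
    have coeff: "coeff c j = (if j \<in> J then v j else 0)" for j
      using J(1) by (simp add: c_def coeff_sum)
    have "radical c" unfolding radical_def
    proof
      fix i assume i: "i \<in> exponents K"
      have "(\<Sum>j\<in>J. v j * (of_int (int j - i) * F (i + int j - 1))) =
          (\<Sum>j\<in>J. \<Sum>k<R. p k i * (v j * q k (int j)))"
        using rank[OF i exponents_of_nat] by (simp add: sum_distrib_left mult_ac)
      also have "\<dots> = (\<Sum>k<R. p k i * (\<Sum>j\<in>J. v j * q k (int j)))"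
        by (subst sum.swap) (simp add: sum_distrib_left)
      also have "\<dots> = 0" by (simp add: v(2))
      finally have "0 = (\<Sum>j\<in>J. v j * (of_int (int j - i) * F (i + int j - 1)))" by simp
      \<comment> \<open>Writing j - i as (i + j) - 2 i turns the first part into
        \<open>theta F\<close> at \<open>i + int j\<close>.\<close>
      also have "\<dots> = (\<Sum>j\<in>J. v j * theta F (i + int j) - 2 * of_int i * (v j * F (i - 1 + int j)))"
        by (rule sum.cong) (simp_all add: theta_def algebra_simps)
      also have "\<dots> = act c (theta F) i - 2 * of_int i * act c F (i - 1)"
        by (simp add: c_def act_sum act_monom sum_subtractf sum_distrib_left)
      also have "\<dots> = act (pderiv c) F i - of_int i * act c F (i - 1)"
        by (simp add: act_theta)
      finally show "act (pderiv c) F i = theta (act c F) i" by (simp add: theta_def)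
    qed
    then show ?thesis using v(1) coeff by (intro exI[of _ c]) auto
  qed
  \<comment> \<open>\<open>R + 1\<close> unknowns against \<open>R\<close> equations, and every
    exponent in the window for \<open>d\<close> exceeds those in the window for
    \<open>c\<close>.\<close>
  obtain c where c: "radical c" "\<exists>j\<in>{..R}. coeff c j \<noteq> 0" "\<And>j. j \<notin> {..R} \<Longrightarrow> coeff c j = 0"
    using ex[of "{..R}"] by auto
  obtain d where d: "radical d" "\<exists>j\<in>{R + 1..2 * R + 1}. coeff d j \<noteq> 0"
    using ex[of "{R + 1..2 * R + 1}"] by auto
  have "c \<noteq> 0" using c(2) by auto
  moreover have "degree c < degree d"
  proof -
    have "degree c \<le> R" using c(3) by (intro degree_le) auto
    moreover obtain j where "j \<ge> R + 1" "coeff d j \<noteq> 0" using d(2) by auto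
    then have "R + 1 \<le> degree d" using le_degree[of d j] by linarith
    ultimately show ?thesis by simp
  qed
  ultimately have "d * pderiv c - c * pderiv d \<noteq> 0" by (rule wronskian_nonzero)
  moreover have "annihilates K (d * pderiv c - c * pderiv d) F"
    using c(1) d(1) by (intro annihilates_wronskian) (auto simp: radical_def)
  ultimately show ?thesis unfolding recurrent_iff by blast
qed

text \<open>
  Second differences along the antidiagonals \<open>i + j = const\<close> kill the terms \<open>(j - i) F (i + j - 1)\<close>
  and turn the cubic cocycle into a multiple of \<open>i\<close> on a single antidiagonal, which has infinite
  rank unless \<open>\<gamma> = 0\<close>.
\<close>

lemma finite_rank_cocycle:
  fixes F :: "int \<Rightarrow> 'a::field_char_0" and p q :: "nat \<Rightarrow> int \<Rightarrow> 'a"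
  assumes rank: "\<And>i j. of_int (j - i) * F (i + j - 1) +
      (if i + j = 2 then of_int ((i - 1) ^ 3 - (i - 1)) / 12 * \<gamma> else 0) = (\<Sum>k<R. p k i * q k j)"
  shows "\<gamma> = 0"
proof -
  define M where "M i j = (\<Sum>k<R. p k i * q k j)" for i j
  \<comment> \<open>\<open>3 * R + 1\<close> points for the \<open>3 * R\<close> conditions below;
    starting at 3 keeps \<open>2 - j0\<close> nonzero at the end.\<close>
  define J where "J = {3..3 + 3 * int R}"
  have J: "finite J" "card J > 3 * R" by (simp_all add: J_def)
  \<comment> \<open>The index encodes a factor \<open>k div 3\<close> and a shift
    \<open>k mod 3\<close>: one vector has to annihilate the columns at \<open>j\<close>,
    \<open>j - 1\<close> and \<open>j - 2\<close> simultaneously, as the second difference involves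
    all three.\<close>
  obtain v where v: "\<exists>j\<in>J. v j \<noteq> 0"
      "\<And>k. k < 3 * R \<Longrightarrow> (\<Sum>j\<in>J. v j * q (k div 3) (j - int (k mod 3))) = 0"
    using underdetermined_system[OF J, of "\<lambda>k j. q (k div 3) (j - int (k mod 3))"] by blast
  have "(\<Sum>j\<in>J. v j * M i (j - int e)) = 0" if "e < 3" for i e
  proof -
    have "(\<Sum>j\<in>J. v j * M i (j - int e)) = (\<Sum>k<R. p k i * (\<Sum>j\<in>J. v j * q k (j - int e)))"
      unfolding M_def sum_distrib_left by (subst sum.swap) (simp add: mult_ac)
    also have "\<dots> = 0"
    proof (rule sum.neutral, rule ballI)
      fix k assume "k \<in> {..<R}"
      then show "p k i * (\<Sum>j\<in>J. v j * q k (j - int e)) = 0"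
        using v(2)[of "3 * k + e"] that by simp
    qed
    finally show ?thesis .
  qed
  from this[of 0] this[of 1] this[of 2]
  have 0: "(\<Sum>j\<in>J. v j * M i j) = 0" "(\<Sum>j\<in>J. v j * M i (j - 1)) = 0" "(\<Sum>j\<in>J. v j * M i (j - 2)) =
      0" for i
    by simp_all
  have "(\<Sum>j\<in>J. v j * (M i j - 2 * M (i + 1) (j - 1) + M (i + 2) (j - 2))) =
      (\<Sum>j\<in>J. v j * M i j) - 2 * (\<Sum>j\<in>J. v j * M (i + 1) (j - 1)) + (\<Sum>j\<in>J. v j * M (i + 2)
          (j - 2))" for i
    by (simp add: sum_distrib_left sum_subtractf sum.distrib ring_distribs mult.left_commute)
  then have "(\<Sum>j\<in>J. v j * (M i j - 2 * M (i + 1) (j - 1) + M (i + 2) (j - 2))) = 0" for i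
    unfolding 0 by simp
  moreover have "M i j - 2 * M (i + 1) (j - 1) + M (i + 2) (j - 2) = (if i + j =
      2 then of_int i / 2 * \<gamma> else 0)" for i j
  proof -
    define w where "w i = (i - 1) ^ 3 - (i - 1)" for i :: int
    \<comment> \<open>Second difference of the cubic; divided by 12 it gives
      \<open>of_int i / 2\<close>.\<close>
    have "w i - 2 * w (i + 1) + w (i + 2) = 6 * i"
      by (simp add: w_def power3_eq_cube algebra_simps)
    from arg_cong[OF this, of "of_int :: int \<Rightarrow> 'a"]
    have w: "of_int (w (i + 2)) = 6 * of_int i - of_int (w i) + 2 * (of_int (w (i + 1)) :: 'a)"
      by (simp add: algebra_simps)
    show ?thesis
      unfolding M_def rank [symmetric] w_def [symmetric] w by (auto simp: field_simps)
  qed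
  ultimately have sum: "(\<Sum>j\<in>J. v j * (if i + j = 2 then of_int i / 2 * \<gamma> else 0)) = 0" for i
    by simp
  obtain j0 where j0: "j0 \<in> J" "v j0 \<noteq> 0" using v(1) by blast
  \<comment> \<open>Row \<open>2 - j0\<close> meets the antidiagonal only in column
    \<open>j0\<close>, which isolates \<open>v j0\<close>.\<close>
  have "(\<Sum>j\<in>J. v j * (if 2 - j0 + j = 2 then of_int (2 - j0) / 2 * \<gamma> else 0)) =
      (\<Sum>j\<in>J. if j = j0 then v j0 * (of_int (2 - j0) / 2 * \<gamma>) else 0)"
    by (rule sum.cong) auto
  with sum[of "2 - j0"] j0(1) J(1) have "v j0 * (of_int (2 - j0) / 2 * \<gamma>) = 0"
    by simp
  moreover have "of_int (2 - j0) \<noteq> (0 :: 'a)"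
    using j0(1) unfolding of_int_eq_0_iff by (simp add: J_def)
  ultimately show ?thesis using j0(2) by simp
qed

lemma good_subspace_recurrent:
  fixes G :: "((witt_index \<Rightarrow> 'a::field_char_0) \<Rightarrow> 'a) set"
  assumes "good_subspace (witt_space K) (witt_bracket K) G"
  shows "G \<subseteq> {eps_sum K F | F. recurrent K F}"
proof
  fix f assume "f \<in> G"
  with assms have f: "f \<in> dual_space (witt_space K)"
    and T: "dual_cobracket (witt_space K) (witt_bracket K) f \<in> tensor G G"
    by (auto simp: good_subspace_def)
  obtain R :: nat and p q where
    rank: "\<forall>s t. dual_cobracket (witt_space K) (witt_bracket K) f (s, t) = (\<Sum>k<R. p k s * q k t)"
    using tensor_finite_rank[OF T] by (elim exE)
  define F where "F i = f (xpow i)" for i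
  define \<gamma> where "\<gamma> = f (unit_vector Central)"
  have entry: "of_int (j - i) * F (i + j - 1) +
      (if K = Virasoro \<and> i + j = 2 then of_int ((i - 1) ^ 3 - (i - 1)) / 12 * \<gamma> else 0) =
      (\<Sum>k<R. p k (xpow i) * q k (xpow j))"
    if "i \<in> exponents K" "j \<in> exponents K" for i j
  proof -
    have "f (basis_bracket K (Pow i) (Pow j)) = dual_cobracket (witt_space K) (witt_bracket K) f
        (xpow i, xpow j)"
      using that by (simp add: dual_cobracket_def del: basis_bracket.simps)
    then show ?thesis
      unfolding functional_basis_bracket[OF f that] F_def \<gamma>_def using rank by (simp only:)
  qed
  \<comment> \<open>This removes the cocycle, and from here on the three algebras are treated
    alike.\<close>
  have central: "\<gamma> = 0" if "K = Virasoro"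
  proof (rule finite_rank_cocycle)
    show "of_int (j - i) * F (i + j - 1) +
      (if i + j = 2 then of_int ((i - 1) ^ 3 - (i - 1)) / 12 * \<gamma> else 0) =
          (\<Sum>k<R. p k (xpow i) * q k (xpow j))" for i j
      using entry[of i j] that by (simp add: exponents_def)
  qed
  have "of_int (j - i) * F (i + j - 1) = (\<Sum>k<R. p k (xpow i) * q k (xpow j))"
    if "i \<in> exponents K" "j \<in> exponents K" for i j
  proof -
    have "(if K = Virasoro \<and> i + j = 2 then of_int ((i - 1) ^ 3 - (i - 1)) / 12 * \<gamma> else 0) = 0"
      using central by simp
    then show ?thesis using entry[OF that] by (simp only: add_0_right)
  qed
  then have "recurrent K F" by (rule finite_rank_recurrent)
  moreover have "f = eps_sum K F"
    by (rule dual_witt_space_eqI[OF f eps_sum_dual])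
      (use central in \<open>auto simp: eps_sum_unit_vector F_def \<gamma>_def witt_basis_def split: if_splits\<close>)
  ultimately show "f \<in> {eps_sum K F | F. recurrent K F}" by blast
qed

lemma finite_dual_witt:
  "finite_dual (witt_space K) (witt_bracket K) = {eps_sum K F | F. recurrent K (F :: int \<Rightarrow>
      'a::field_char_0)}"
proof
  show "finite_dual (witt_space K) (witt_bracket K) \<subseteq> {eps_sum K F | F. recurrent K (F :: int \<Rightarrow>
      'a)}"
    unfolding finite_dual_def
    by (rule fun_space.span_minimal[OF _ subspace_recurrent]) (use good_subspace_recurrent in auto)
  show "{eps_sum K F | F. recurrent K (F :: int \<Rightarrow> 'a)} \<subseteq> finite_dual (witt_space K) (witt_bracket
      K)"
    unfolding finite_dual_def
    by (rule subset_trans[OF Union_upper fun_space.span_superset]) (simp add: good_recurrent)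
qed

section \<open>Sums by evaluation\<close>

lemma sums_by_evaluationI:
  assumes "\<And>p. \<exists>S. finite S \<and> S \<subseteq> I \<and> {i \<in> I. \<Phi> i p \<noteq> 0} \<subseteq> S \<and> g p = (\<Sum>i\<in>S. \<Phi> i p)"
  shows "sums_by_evaluation I \<Phi> g"
  unfolding sums_by_evaluation_def
proof (intro allI conjI)
  fix p
  obtain S where S: "finite S" "S \<subseteq> I" "{i \<in> I. \<Phi> i p \<noteq> 0} \<subseteq> S" "g p = (\<Sum>i\<in>S. \<Phi> i p)"
    using assms[of p] by (elim exE conjE)
  show "finite {i \<in> I. \<Phi> i p \<noteq> 0}" using S(1,3) by (rule finite_subset[rotated])
  show "g p = (\<Sum>i | i \<in> I \<and> \<Phi> i p \<noteq> 0. \<Phi> i p)"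
    unfolding S(4) by (rule sum.mono_neutral_right) (use S in auto)
qed

lemma sums_by_evaluation_unique:
  assumes "sums_by_evaluation I \<Phi> g" "sums_by_evaluation I \<Psi> h" "\<And>i. i \<in> I \<Longrightarrow> \<Phi> i = \<Psi> i"
  shows "g = h"
proof
  fix p
  have "(\<Sum>i | i \<in> I \<and> \<Phi> i p \<noteq> 0. \<Phi> i p) = (\<Sum>i | i \<in> I \<and> \<Psi> i p \<noteq> 0. \<Psi> i p)"
    using assms(3) by (intro sum.cong) auto
  then show "g p = h p" using assms(1,2) unfolding sums_by_evaluation_def by metis
qed

lemma witt_space_Pow_outside: "u \<in> witt_space K \<Longrightarrow> u (Pow i) \<noteq> 0 \<Longrightarrow> i \<in> exponents K"
  by (auto simp: witt_space_def)

lemma eps_apply: "eps K i u = (if u \<in> witt_space K then u (Pow i) else 0)"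
proof (cases "u \<in> witt_space K")
  case True
  then show ?thesis
    unfolding eps_def by (subst eps_sum_superset[of _ _ "insert i {i. u (Pow i) \<noteq> 0}"])
      (auto simp: finite_exponents_support if_distrib[of "\<lambda>x. x * _"] cong: if_cong)
qed (simp add: eps_def eps_sum_outside)

lemma eps_dual: "eps K i \<in> dual_space (witt_space K)"
  unfolding eps_def by (rule eps_sum_dual)

subsection \<open>The cobracket\<close>

text \<open>Brackets with the central element vanish and the cocycle only feeds the central
  coordinate, so one convolution serves all three algebras.\<close>

lemma witt_bracket_Pow:
  assumes u: "u \<in> witt_space K" and v: "v \<in> witt_space K"
  shows "witt_bracket K u v (Pow m) = (\<Sum>i | u (Pow i) \<noteq> 0. \<Sum>j | v (Pow j) \<noteq> 0.
    if i + j = m + 1 then of_int (j - i) * (u (Pow i) * v (Pow j)) else 0)"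
proof -
  have reduce: "(\<Sum>b | w b \<noteq> 0. \<phi> b) = (\<Sum>i | w (Pow i) \<noteq> 0. \<phi> (Pow i))"
    if w: "w \<in> witt_space K" and "\<phi> Central = 0" for w :: "witt_index \<Rightarrow> 'a"
        and \<phi> :: "witt_index \<Rightarrow> 'a"
  proof -
    have "(\<Sum>b | w b \<noteq> 0. \<phi> b) = (\<Sum>b\<in>Pow ` {i. w (Pow i) \<noteq> 0}. \<phi> b)"
    proof (rule sum.mono_neutral_right)
      show "\<forall>b\<in>{b. w b \<noteq> 0} - Pow ` {i. w (Pow i) \<noteq> 0}. \<phi> b = 0"
      proof
        fix b assume "b \<in> {b. w b \<noteq> 0} - Pow ` {i. w (Pow i) \<noteq> 0}"
        then show "\<phi> b = 0" using that(2) by (cases b) auto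
      qed
    qed (use finite_support_witt_space[OF w] in auto)
    also have "\<dots> = (\<Sum>i | w (Pow i) \<noteq> 0. \<phi> (Pow i))"
      by (subst sum.reindex) (auto simp: inj_on_def)
    finally show ?thesis .
  qed
  have zero: "basis_bracket K b Central x = 0" for b x by (cases b) auto
  have "witt_bracket K u v (Pow m) = (\<Sum>b | u b \<noteq> 0. \<Sum>b' | v b' \<noteq> 0. u b * v b' * basis_bracket K b
      b' (Pow m))"
    by (simp add: witt_bracket_def sum_fun_apply)
  also have "\<dots> = (\<Sum>i | u (Pow i) \<noteq> 0. \<Sum>b' | v b' \<noteq> 0. u (Pow i) * v b' * basis_bracket K (Pow i)
      b' (Pow m))"
    by (rule reduce[OF u]) simp
  also have "\<dots> = (\<Sum>i | u (Pow i) \<noteq> 0. \<Sum>j | v (Pow j) \<noteq> 0. u (Pow i) * v (Pow j) * basis_bracket K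
      (Pow i) (Pow j) (Pow m))"
    by (intro sum.cong refl reduce[OF v]) simp
  also have "\<dots> = (\<Sum>i | u (Pow i) \<noteq> 0. \<Sum>j | v (Pow j) \<noteq> 0.
    if i + j = m + 1 then of_int (j - i) * (u (Pow i) * v (Pow j)) else 0)"
    by (intro sum.cong refl) auto
  finally show ?thesis .
qed

text \<open>At a pair of vectors only exponents in finite supports matter, which settles both
  finiteness and value of the sums.\<close>

lemma cobracket_description_dual:
  "cobracket_description K D (dual_cobracket (witt_space K) (witt_bracket K :: (witt_index \<Rightarrow>
      'a::field_char_0) \<Rightarrow> _))"
  unfolding cobracket_description_def
proof (intro conjI ballI allI impI)
  fix m assume "m \<in> exponents K"
  show "sums_by_evaluation {(i, j). i \<in> exponents K \<and> j \<in> exponents K \<and> i + j = m + 1}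
    (\<lambda>(i, j). fscale (of_int (j - i)) (pure_tensor (eps K i) (eps K j)))
    (dual_cobracket (witt_space K) (witt_bracket K) (eps K m) :: (witt_index \<Rightarrow> 'a) \<times>
        (witt_index \<Rightarrow> 'a) \<Rightarrow> 'a)"
  proof (rule sums_by_evaluationI)
    fix p :: "(witt_index \<Rightarrow> 'a) \<times> (witt_index \<Rightarrow> 'a)"
    obtain u v where p: "p = (u, v)" by (cases p)
    show "\<exists>S. finite S \<and> S \<subseteq> {(i, j). i \<in> exponents K \<and> j \<in> exponents K \<and> i + j = m + 1} \<and>
      {i \<in> {(i, j). i \<in> exponents K \<and> j \<in> exponents K \<and> i + j = m + 1}.
        (case i of (i, j) \<Rightarrow> fscale (of_int (j - i)) (pure_tensor (eps K i) (eps K j))) p \<noteq> 0} \<subseteq> S \<and>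
      dual_cobracket (witt_space K) (witt_bracket K) (eps K m) p =
        (\<Sum>i\<in>S. (case i of (i, j) \<Rightarrow> fscale (of_int (j - i)) (pure_tensor (eps K i) (eps K j))) p)"
    proof (cases "u \<in> witt_space K \<and> v \<in> witt_space K")
      case False
      then show ?thesis
        by (intro exI[of _ "{}"]) (auto simp: p dual_cobracket_def eps_apply)
    next
      case True
      then have u: "u \<in> witt_space K" and v: "v \<in> witt_space K" by auto
      let ?Su = "{i. u (Pow i) \<noteq> 0}" and ?Sv = "{i. v (Pow i) \<noteq> 0}"
      have fin: "finite (?Su \<times> ?Sv)" using u v by (simp add: finite_exponents_support)
      have "dual_cobracket (witt_space K) (witt_bracket K) (eps K m) p =
          (\<Sum>z\<in>?Su \<times> ?Sv. if fst z + snd z = m + 1 then of_int (snd z - fst z) * (u (Pow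
              (fst z)) * v (Pow (snd z))) else 0)"
        using u v by (simp add: p dual_cobracket_def eps_apply witt_bracket_in_witt_space
          witt_bracket_Pow
          sum.cartesian_product case_prod_unfold)
      also have "\<dots> = (\<Sum>z\<in>{z \<in> ?Su \<times> ?Sv. fst z + snd z = m + 1}. of_int (snd z - fst z) * (u (Pow
          (fst z)) * v (Pow (snd z))))"
        by (rule sum.inter_filter[OF fin, symmetric])
      finally show ?thesis
        using u v fin by (intro exI[of _ "{z \<in> ?Su \<times> ?Sv. fst z + snd z = m + 1}"])
          (auto simp: p eps_apply case_prod_unfold witt_space_Pow_outside)
    qed
  qed
next
  fix F assume "eps_sum K F \<in> D"
  show "sums_by_evaluation (exponents K)
    (\<lambda>m. fscale (F m) (dual_cobracket (witt_space K) (witt_bracket K) (eps K m)))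
    (dual_cobracket (witt_space K) (witt_bracket K) (eps_sum K F) :: (witt_index \<Rightarrow> 'a) \<times>
        (witt_index \<Rightarrow> 'a) \<Rightarrow> 'a)"
  proof (rule sums_by_evaluationI)
    fix p :: "(witt_index \<Rightarrow> 'a) \<times> (witt_index \<Rightarrow> 'a)"
    obtain u v where p: "p = (u, v)" by (cases p)
    show "\<exists>S. finite S \<and> S \<subseteq> exponents K \<and>
      {m \<in> exponents K. fscale (F m) (dual_cobracket (witt_space K) (witt_bracket K)
          (eps K m)) p \<noteq> 0} \<subseteq> S \<and>
      dual_cobracket (witt_space K) (witt_bracket K) (eps_sum K F) p =
        (\<Sum>m\<in>S. fscale (F m) (dual_cobracket (witt_space K) (witt_bracket K) (eps K m)) p)"
    proof (cases "u \<in> witt_space K \<and> v \<in> witt_space K")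
      case False
      then show ?thesis
        by (intro exI[of _ "{}"]) (auto simp: p dual_cobracket_def)
    next
      case True
      \<comment> \<open>At \<open>(u, v)\<close> every cobracket is evaluation at this single
        vector, so the sum over \<open>m\<close> is the finite sum that defines
        \<open>eps_sum\<close>.\<close>
      define w where "w = witt_bracket K u v"
      have w: "w \<in> witt_space K" using True by (simp add: w_def witt_bracket_in_witt_space)
      have dc: "dual_cobracket (witt_space K) (witt_bracket K) f p = f w" for f
        using True by (simp add: p dual_cobracket_def w_def)
      show ?thesis
        unfolding fscale_apply dc eps_apply
        using w by (intro exI[of _ "{i. w (Pow i) \<noteq> 0}"])
          (auto simp: finite_exponents_support witt_space_Pow_outside eps_sum_def)
    qed
  qed
qed

lemma cobracket_description_unique:
  assumes "cobracket_description K D \<Delta>" "cobracket_description K D \<Delta>'" "eps_sum K F \<in> D"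
  shows "\<Delta> (eps_sum K F) = \<Delta>' (eps_sum K F)"
proof -
  note cd = assms(1,2)[unfolded cobracket_description_def]
  have "\<Delta> (eps K m) = \<Delta>' (eps K m)" if "m \<in> exponents K" for m
    by (rule sums_by_evaluation_unique[OF cd(1)[THEN conjunct1, THEN bspec, OF that]
          cd(2)[THEN conjunct1, THEN bspec, OF that] refl])
  then show ?thesis
    by (intro sums_by_evaluation_unique[OF cd(1)[THEN conjunct2, THEN spec, THEN mp, OF assms(3)]
          cd(2)[THEN conjunct2, THEN spec, THEN mp, OF assms(3)]]) simp
qed

subsection \<open>The bracket\<close>

lemma bracket_description_unique:
  assumes B: "bracket_description K n D B" and B': "bracket_description K n D B'"
    and FG: "eps_sum K F \<in> D" "eps_sum K G \<in> D"
  shows "B (eps_sum K F) (eps_sum K G) = B' (eps_sum K F) (eps_sum K G)"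
proof -
  note bd = B[unfolded bracket_description_def] B'[unfolded bracket_description_def]
  note table = bd[THEN conjunct1]
  note skew = bd[THEN conjunct2, THEN conjunct1, rule_format]
  \<comment> \<open>The table covers these pairs entirely; in the one-sided case the row
    \<open>i = 1\<close> is split at \<open>j = n - 1\<close>.\<close>
  have eq1: "B (eps K i) (eps K j) = B' (eps K i) (eps K j)"
    if "i \<in> exponents K" "j \<in> exponents K" "i = 1 \<and> j \<noteq> 1 \<or> i = n \<and> j \<notin> {1, n} \<or> i \<notin> {1, n} \<and>
        j \<notin> {1, n}" for i j
  proof (cases "K = One_Sided_Witt")
    case True
    have "i \<ge> 0" "j \<ge> 0" using that True by (auto simp: exponents_def)
    with that(3) True table show ?thesis
      unfolding bracket_table_def by (smt (verit) insert_iff empty_iff)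
  next
    case False
    with that(3) table show ?thesis
      unfolding bracket_table_def by (smt (verit) insert_iff empty_iff)
  qed
  \<comment> \<open>The diagonal entries at 1 and \<open>n\<close> need not occur in the table;
    skew-symmetry forces them to be 0.\<close>
  have diag: "C (eps K i) (eps K i) = 0"
    if "\<And>i j. i \<in> exponents K \<Longrightarrow> j \<in> exponents K \<Longrightarrow> C (eps K j) (eps K i) = - C (eps K i) (eps K j)"
      "i \<in> exponents K" for C :: "((witt_index \<Rightarrow> 'a) \<Rightarrow> 'a) \<Rightarrow> ((witt_index \<Rightarrow> 'a) \<Rightarrow> 'a) \<Rightarrow>
          (witt_index \<Rightarrow> 'a) \<Rightarrow> 'a" and i
  proof
    fix u
    have "C (eps K i) (eps K i) u = - C (eps K i) (eps K i) u"
      using fun_cong[OF that(1)[OF that(2) that(2)], of u] by simp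
    then show "C (eps K i) (eps K i) u = 0 u" by simp
  qed
  have "B (eps K i) (eps K j) = B' (eps K i) (eps K j)" if i: "i \<in> exponents K"
      and j: "j \<in> exponents K" for i j
  proof -
    \<comment> \<open>Up to the order of the arguments, every off-diagonal pair is in the
      table.\<close>
    consider "i = j" | "i = 1 \<and> j \<noteq> 1 \<or> i = n \<and> j \<notin> {1, n} \<or> i \<notin> {1, n} \<and> j \<notin> {1, n}"
      | "j = 1 \<and> i \<noteq> 1 \<or> j = n \<and> i \<notin> {1, n} \<or> j \<notin> {1, n} \<and> i \<notin> {1, n}"
      by auto
    then show ?thesis
    proof cases
      case 1
      then show ?thesis using diag[of B, OF skew(1) i] diag[of B', OF skew(2) i] by simp
    next
      case 2
      then show ?thesis by (rule eq1[OF i j])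
    next
      case 3
      then show ?thesis using eq1[OF j i] skew(1)[OF j i] skew(2)[OF j i] by simp
    qed
  qed
  then show ?thesis
    by (intro sums_by_evaluation_unique[OF
          bd[THEN conjunct2, THEN conjunct2, rule_format, OF conjI[OF FG]]]) auto
qed

lemma triangular_pair_witt:
  assumes "K = One_Sided_Witt \<Longrightarrow> n \<ge> 0"
  shows "triangular_pair (witt_space K) (witt_bracket K) (xpow 1) (xpow n) (of_int (n - 1))"
proof
  show "witt_bracket K (xpow 1) (xpow n) = fscale (of_int (n - 1)) (xpow n)"
    by (auto simp: fun_eq_iff)
qed (use assms in \<open>auto simp: exponents_def\<close>)

lemma bracket_description_dual:
  assumes "n \<noteq> 1" and "K = One_Sided_Witt \<Longrightarrow> n \<ge> 0"
  shows "bracket_description K n D (dual_bracket (witt_space K)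
    (witt_cobracket K n :: (witt_index \<Rightarrow> 'a::field_char_0) \<Rightarrow> _))"
proof -
  let ?L = "witt_space K :: (witt_index \<Rightarrow> 'a) set" and ?br =
      "witt_bracket K :: (witt_index \<Rightarrow> 'a) \<Rightarrow> _"
  let ?a = "xpow 1 :: witt_index \<Rightarrow> 'a" and ?b = "xpow n :: witt_index \<Rightarrow> 'a"
  interpret P: triangular_pair ?L ?br ?a ?b "of_int (n - 1)"
    using assms(2) by (rule triangular_pair_witt)
  have \<delta>: "P.\<delta> = witt_cobracket K n"
    by (rule ext) (simp add: P.\<delta>_def P.r_def witt_cobracket_def witt_r_def)
  define db where "db = dual_bracket ?L (witt_cobracket K n)"
  have db: "db f g u = g ?b * f (?br u ?a) - g ?a * f (?br u ?b) + f ?a * g (?br u ?b) - f ?b * g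
      (?br u ?a)"
    if "f \<in> dual_space ?L" "g \<in> dual_space ?L" "u \<in> ?L" for f g u
    using P.dual_bracket_apply[OF that] by (simp add: \<delta> db_def)
  have outside: "db f g u = 0" if "u \<notin> ?L" for f g u
    using that by (simp add: db_def dual_bracket_def)
  have coords: "db (eps K i) (eps K j) u = ?b (Pow j) * ?br u ?a (Pow i) - ?a (Pow j) * ?br u ?b
      (Pow i) +
      ?a (Pow i) * ?br u ?b (Pow j) - ?b (Pow i) * ?br u ?a (Pow j)" if "u \<in> ?L" for i j u
    unfolding db[OF eps_dual eps_dual that] eps_apply
    by (simp only: P.a P.b witt.bracket_closed[OF that P.a] witt.bracket_closed[OF that P.b]
      if_True)
  have skew: "db (eps K j) (eps K i) = - db (eps K i) (eps K j)" for i j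
  proof
    fix u show "db (eps K j) (eps K i) u = (- db (eps K i) (eps K j)) u"
      by (cases "u \<in> ?L") (simp_all add: outside coords)
  qed
  \<comment> \<open>The \<epsilon>^i may lie outside \<open>D\<close>, so their bracket is shown to
    be a functional in the full dual, where values on a basis identify it.\<close>
  have dual: "db (eps K i) (eps K j) \<in> dual_space ?L" for i j
    unfolding dual_space_def
  proof (intro CollectI conjI ballI allI impI outside)
    fix u v assume u: "u \<in> ?L" and v: "v \<in> ?L"
    show "db (eps K i) (eps K j) (u + v) = db (eps K i) (eps K j) u + db (eps K i) (eps K j) v"
      unfolding coords[OF u] coords[OF v] coords[OF witt.add_closed[OF u v]]
        witt.bracket_add_left[OF P.a u v] witt.bracket_add_left[OF P.b u v] plus_fun_apply
      by (simp only: algebra_simps)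
  next
    fix c u assume u: "u \<in> ?L"
    show "db (eps K i) (eps K j) (fscale c u) = c * db (eps K i) (eps K j) u"
      unfolding coords[OF u] coords[OF witt.scale_closed[OF u]]
        witt.bracket_scale_left[OF P.a u] witt.bracket_scale_left[OF P.b u] fscale_apply
      by (simp only: algebra_simps)
  qed
  \<comment> \<open>Obtained from [x^k, x] = (1 - k) x^k and [x^k, x^n] = (n - k) x^(k+n-1), up to
    central terms, which the coordinates do not see.\<close>
  have basis: "db (eps K i) (eps K j) (unit_vector c) = (case c of Central \<Rightarrow> 0 | Pow k \<Rightarrow>
      (if j = n \<and> k = i then of_int (1 - k) else 0) - (if j = 1 \<and> k + n - 1 = i then of_int
          (n - k) else 0) +
      (if i = 1 \<and> k + n - 1 = j then of_int (n - k) else 0) - (if i = n \<and> k = j then of_int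
          (1 - k) else 0))"
    if "c \<in> witt_basis K" for i j c
    using that by (subst coords) (auto split: witt_index.split)
  have table: "db (eps K i) (eps K j) = fscale x (eps K l)"
    if "\<And>k. (if j = n \<and> k = i then of_int (1 - k) else 0) - (if j = 1 \<and> k + n - 1 =
        i then of_int (n - k) else 0) +
      (if i = 1 \<and> k + n - 1 = j then of_int (n - k) else 0) - (if i = n \<and> k = j then of_int
          (1 - k) else 0) =
      (if k = l then x else (0::'a))" for i j l x
  proof (rule dual_witt_space_eqI[OF dual fun_space.subspace_scale[OF subspace_dual_space
      eps_dual]])
    fix c assume c: "c \<in> witt_basis K"
    show "db (eps K i) (eps K j) (unit_vector c) = fscale x (eps K l) (unit_vector c)"
      unfolding basis[OF c] that using c by (auto simp: eps_apply split: witt_index.split)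
  qed
  \<comment> \<open>The coefficient is \<open>n - k\<close> at \<open>k = j + 1 - n\<close>. As
    \<open>n\<close> differs from 1, the conditions \<open>i = 1\<close> and \<open>i = n\<close>
    exclude each other.\<close>
  have table1: "db (eps K 1) (eps K j) = fscale (of_int (2 * n - j - 1)) (eps K (j + 1 - n))"
      if "j \<noteq> 1" for j
    using that assms(1) by (intro table) auto
  have table2: "db (eps K n) (eps K j) = fscale (of_int (j - 1)) (eps K j)" if "j \<noteq> 1" "j \<noteq> n" for j
    using that assms(1) by (intro table) auto
  have table3: "db (eps K i) (eps K j) = 0" if "i \<notin> {1, n}" "j \<notin> {1, n}" for i j
    using table[of j i 0 0] that by simp
  \<comment> \<open>The exponent \<open>j + 1 - n\<close> is negative, where \<open>eps\<close> is
    the zero functional; \<open>j = 1\<close> is excluded from \<open>table1\<close> and follows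
    from skew-symmetry.\<close>
  have table4: "db (eps K 1) (eps K j) = 0" if "K = One_Sided_Witt" "j < n - 1" for j
  proof -
    have "eps K (j + 1 - n) = (0 :: _ \<Rightarrow> 'a)"
      using that witt_space_Pow_outside[of _ K "j + 1 - n"]
        by (force simp: fun_eq_iff eps_apply exponents_def)
    moreover have "db (eps K 1) (eps K 1) = 0"
      using skew[of 1 1] by (auto simp: fun_eq_iff)
    ultimately show ?thesis using table1[of j] by (cases "j = 1") auto
  qed
  have "bracket_table K n db"
    unfolding bracket_table_def using table1 table2 table3 table4 by auto
  moreover have "sums_by_evaluation (exponents K \<times> exponents K)
      (\<lambda>(i, j). fscale (F i * G j) (db (eps K i) (eps K j))) (db (eps_sum K F)
          (eps_sum K G))" for F G
  proof (rule sums_by_evaluationI)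
    fix u :: "witt_index \<Rightarrow> 'a"
    show "\<exists>S. finite S \<and> S \<subseteq> exponents K \<times> exponents K \<and>
      {z \<in> exponents K \<times> exponents K. (case z of (i, j) \<Rightarrow> fscale (F i * G j) (db (eps K i)
          (eps K j))) u \<noteq> 0} \<subseteq> S \<and>
      db (eps_sum K F) (eps_sum K G) u = (\<Sum>z\<in>S. (case z of (i, j) \<Rightarrow> fscale (F i * G j) (db
          (eps K i) (eps K j))) u)"
    proof (cases "u \<in> ?L")
      case False
      then show ?thesis by (intro exI[of _ "{}"]) (auto simp: outside)
    next
      case u: True
      define s where "s w = {i. w (Pow i) \<noteq> (0::'a)}" for w
      \<comment> \<open>Outside \<open>T\<close> all four coordinate functions in
        \<open>coords\<close> vanish, so \<open>T \<times> T\<close> carries every nonzero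
        term.\<close>
      define T where "T = s ?a \<union> s ?b \<union> s (?br u ?a) \<union> s (?br u ?b)"
      have L: "?a \<in> ?L" "?b \<in> ?L" "?br u ?a \<in> ?L" "?br u ?b \<in> ?L" using u
          by (simp_all only: P.a P.b witt.bracket_closed)
      have fs: "finite (s w)" "s w \<subseteq> exponents K" if "w \<in> ?L" for w
        using finite_exponents_support[OF that] witt_space_Pow_outside[OF that] unfolding s_def
          by auto
      have T: "finite T" "T \<subseteq> exponents K" using fs[OF L(1)] fs[OF L(2)] fs[OF L(3)] fs[OF L(4)]
          by (auto simp: T_def)
      have ev: "eps_sum K H ?a = (\<Sum>i\<in>T. H i * ?a (Pow i))" "eps_sum K H ?b =
          (\<Sum>i\<in>T. H i * ?b (Pow i))"
        "eps_sum K H (?br u ?a) = (\<Sum>i\<in>T. H i * ?br u ?a (Pow i))"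
        "eps_sum K H (?br u ?b) = (\<Sum>i\<in>T. H i * ?br u ?b (Pow i))" for H
        using T(1) L by (intro eps_sum_superset; force simp: T_def s_def)+
      have notin: "?a (Pow i) = 0" "?b (Pow i) = 0" "?br u ?a (Pow i) = 0" "?br u ?b (Pow i) = 0"
          if "i \<notin> T" for i
        using that by (auto simp: T_def s_def)
      have zero: "db (eps K i) (eps K j) u = 0" if "i \<notin> T \<or> j \<notin> T" for i j
        using that
      proof
        assume "i \<notin> T"
        then show ?thesis unfolding coords[OF u] notin[OF \<open>i \<notin> T\<close>] by simp
      next
        assume "j \<notin> T"
        then show ?thesis unfolding coords[OF u] notin[OF \<open>j \<notin> T\<close>] by simp
      qed
      then have in_T: "i \<in> T" "j \<in> T" if "db (eps K i) (eps K j) u \<noteq> 0" for i j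
        using that by blast+
      have product: "(\<Sum>i\<in>T. F i * x i) * (\<Sum>j\<in>T. G j * y j) =
          (\<Sum>i\<in>T. \<Sum>j\<in>T. F i * G j * (x i * y j))" for x y
        by (simp add: sum_product mult_ac)
      have "db (eps_sum K F) (eps_sum K G) u =
          (\<Sum>i\<in>T. \<Sum>j\<in>T. F i * G j * (?br u ?a (Pow i) * ?b (Pow j))) - (\<Sum>i\<in>T. \<Sum>j\<in>T. F i * G j *
              (?br u ?b (Pow i) * ?a (Pow j))) +
          (\<Sum>i\<in>T. \<Sum>j\<in>T. F i * G j * (?a (Pow i) * ?br u ?b (Pow j))) - (\<Sum>i\<in>T. \<Sum>j\<in>T. F i * G j * (?b
              (Pow i) * ?br u ?a (Pow j)))"
        unfolding db[OF eps_sum_dual eps_sum_dual u] ev product [symmetric]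
          by (simp only: mult.commute)
      also have "\<dots> = (\<Sum>i\<in>T. \<Sum>j\<in>T. F i * G j * db (eps K i) (eps K j) u)"
        unfolding coords[OF u] sum_subtractf [symmetric] sum.distrib [symmetric]
        by (intro sum.cong refl) (simp only: ring_distribs mult_ac)
      finally show ?thesis
        using T in_T by (intro exI[of _ "T \<times> T"])
          (auto simp: sum.cartesian_product case_prod_unfold)
    qed
  qed
  ultimately show ?thesis
    unfolding bracket_description_def db_def [symmetric] using skew by blast
qed

theorem theorem4p6:
  fixes K :: witt_kind and n :: int
    and L :: "(witt_index \<Rightarrow> 'a::{alg_closed_field, field_char_0}) set"
  defines "L \<equiv> witt_space K"
  defines "br \<equiv> witt_bracket K"
  defines "\<delta> \<equiv> witt_cobracket K n"
  defines "D \<equiv> finite_dual L br"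
  assumes "n \<noteq> 1" and "K = One_Sided_Witt \<Longrightarrow> n \<ge> 0"
  shows "triangular_lie_bialgebra L br \<delta> (witt_r n) \<and>
    lie_bialgebra D (dual_bracket L \<delta>) (dual_cobracket L br) \<and>
    D = {eps_sum K F | F. recurrent K F} \<and>
    cobracket_description K D (dual_cobracket L br) \<and>
    (\<forall>\<Delta>. cobracket_description K D \<Delta> \<longrightarrow> (\<forall>f\<in>D. \<Delta> f = dual_cobracket L br f)) \<and>
    bracket_description K n D (dual_bracket L \<delta>) \<and>
    (\<forall>B. bracket_description K n D B \<longrightarrow> (\<forall>f\<in>D. \<forall>g\<in>D. B f g = dual_bracket L \<delta> f g))"
proof -
  interpret P: triangular_pair L br "xpow 1" "xpow n" "of_int (n - 1)"
    unfolding L_def br_def using assms(6) by (rule triangular_pair_witt)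
  have r: "P.r = witt_r n"
    by (simp only: P.r_def witt_r_def)
  have \<delta>: "P.\<delta> = \<delta>"
    unfolding assms(3) by (rule ext, subst P.\<delta>_def) (simp only: r witt_cobracket_def br_def)
  have D: "D = {eps_sum K F | F. recurrent K F}"
    unfolding D_def L_def br_def by (rule finite_dual_witt)
  have cobracket: "cobracket_description K D (dual_cobracket L br)"
    unfolding L_def br_def by (rule cobracket_description_dual)
  have bracket: "bracket_description K n D (dual_bracket L \<delta>)"
    unfolding L_def assms(3) using assms(5,6) by (rule bracket_description_dual)
  have "triangular_lie_bialgebra L br \<delta> (witt_r n)"
    using P.triangular_lie_bialgebra_pair unfolding \<delta> r .
  moreover have "lie_bialgebra D (dual_bracket L \<delta>) (dual_cobracket L br)"
  proof -
    \<comment> \<open>The finite dual is defined as the span of all good subspaces;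
      \<open>lie_bialgebra_dual\<close> asks that it be good itself.\<close>
    have "good_subspace L br D"
      unfolding D L_def br_def by (rule good_recurrent)
    then show ?thesis using P.lie_bialgebra_dual[of D] unfolding \<delta> by blast
  qed
  moreover have "\<Delta> f = dual_cobracket L br f" if "cobracket_description K D \<Delta>" "f \<in> D" for \<Delta> f
    using cobracket_description_unique[OF that(1) cobracket] that(2) D by auto
  moreover have "B f g = dual_bracket L \<delta> f g" if "bracket_description K n D B" "f \<in> D" "g \<in> D"
      for B f g
    using bracket_description_unique[OF that(1) bracket] that(2,3) D by auto
  ultimately show ?thesis
    using D cobracket bracket by blast
qed

end
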